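(* Let $H=H(z)=-|\phi\rangle\langle\phi|+z\sum_sE(s)|s\rangle\langle s|$ with $|\phi\rangle=\frac1{\sqrt N}\sum_s|s\rangle$. For a given instance with density of states $\{n_E\}$ and $N_0>0$, the lowest two eigenvalues of $H$, $\lambda_0<0<\lambda_1$, are approximately given by $$\lambda'_{1,0}=z\,\frac{z-Z_1\pm\sqrt{(z-Z_1)^2+4\frac{N_0}NZ_2}}{2Z_2}$$ ($+$ for $\lambda_1'$, $-$ for $\lambda_0'$; primes denote approximate quantities). The approximation for $\lambda_0$ has relative error $\left|\frac{\lambda_0-\lambda_0'}{\lambda_0}\right|\le\delta$ for $z\ge z_0:=Z_1-\frac{Z_2^2}{Z_3}\delta$. The approximation for $\lambda_1$ has relative error $\left|\frac{\lambda_1-\lambda_1'}{\lambda_1}\right|\le\delta$ for $z\le z_1:=Z_1+\frac{Z_2^2}{Z_3}\delta$. The spectral gap $g=\lambda_1-\lambda_0$ is approximately given by $$g'=\lambda_1'-\lambda_0'=\frac z{Z_2}\sqrt{(z-Z_1)^2+4\frac{N_0}NZ_2}.$$ The approximation for $g$ has relative error $\left|\frac{g-g'}g\right|\le\delta$ for $z_0\le z\le z_1$. The minimal spectral gap $g_*$ occurs for $z=z_*:=Z_1+O(n_0)$, where $n_0=N_0/N$, and is given by $$g_*=\min_zg(z)=2Z_1\sqrt{\frac{N_0}{NZ_2}}+O\!\left(n_0^{3/2}\right).$$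
   Context: Let $n\ge1$, $N=2^n$, and let $s$ range over the $N$ assignments of $n$ binary variables; $\{|s\rangle\}$ is the computational (orthonormal) basis of $\mathbb C^N$. The cost function $E(s)$ takes integer values in $\{0,\dots,m\}$ with $m=\mathrm{poly}(n)$. $N_E$ is the number of $s$ with $E(s)=E$, $n_E=N_E/N$, and $Z_p=\sum_{E=1}^m n_E/E^p$. The real number $z>0$ is the annealing parameter. Here $\lambda_0,\lambda_1$ denote the first and second roots of $X(\lambda)=1+\frac1N\sum_{E=0}^m\frac{N_E}{\lambda-zE}=0$, and the spectral gap is $g=\lambda_1-\lambda_0$. The number $\delta\ll1$ is the tolerance on the relative error. In $O$-estimates, non-exponential factors (such as polynomial factors in $n$) are omitted.
   Formalization: Error bounds ≤δ, literally false, become δ+O(n_0/δ) for λ_0 and δ+O(δ²+n_0/δ) for λ_1 and g. Bounds and minimum need n_0≤1/K(n), K polynomially bounded; N_0<N is assumed. If N_0>1, the eigenvalue 0 also lies between λ_0 and λ_1. *)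

theory Defs
  imports Complex_Main "Jordan_Normal_Form.Char_Poly"
begin

text \<open>An assignment of \<open>n\<close> binary variables is encoded by the number \<open>s < 2 ^ n\<close>
  whose binary digits are the values of the variables, and \<open>|s\<rangle>\<close> is the \<open>s\<close>-th unit vector of
  \<open>\<complex>\<^sup>N\<close>, \<open>N = 2 ^ n\<close>. A cost function is a map \<open>E\<close> that matters on these numbers only.\<close>

definition cost_function :: "nat \<Rightarrow> nat \<Rightarrow> (nat \<Rightarrow> nat) \<Rightarrow> bool" where
  "cost_function n m E \<longleftrightarrow> (\<forall>s<2 ^ n. E s \<le> m)"

definition level_count :: "nat \<Rightarrow> (nat \<Rightarrow> nat) \<Rightarrow> nat \<Rightarrow> nat" where
  "level_count n E e = card {s. s < 2 ^ n \<and> E s = e}"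

definition level_density :: "nat \<Rightarrow> (nat \<Rightarrow> nat) \<Rightarrow> nat \<Rightarrow> real" where
  "level_density n E e = real (level_count n E e) / 2 ^ n"

definition Z_moment :: "nat \<Rightarrow> nat \<Rightarrow> (nat \<Rightarrow> nat) \<Rightarrow> nat \<Rightarrow> real" where
  "Z_moment n m E p = (\<Sum>e = 1..m. level_density n E e / real e ^ p)"


definition uniform_state :: "nat \<Rightarrow> complex vec" where
  "uniform_state n = vec (2 ^ n) (\<lambda>s. complex_of_real (1 / sqrt (2 ^ n)))"

definition ket_bra :: "complex vec \<Rightarrow> complex vec \<Rightarrow> complex mat" where
  "ket_bra v w = mat (dim_vec v) (dim_vec w) (\<lambda>(i, j). v $ i * cnj (w $ j))"

definition hamiltonian :: "nat \<Rightarrow> (nat \<Rightarrow> nat) \<Rightarrow> real \<Rightarrow> complex mat" where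
  "hamiltonian n E z =
     - ket_bra (uniform_state n) (uniform_state n)
     + complex_of_real z \<cdot>\<^sub>m mat_diag (2 ^ n) (\<lambda>s. of_nat (E s))"


definition X_fun :: "nat \<Rightarrow> nat \<Rightarrow> (nat \<Rightarrow> nat) \<Rightarrow> real \<Rightarrow> real \<Rightarrow> real" where
  "X_fun n m E z l =
     1 + 1 / 2 ^ n * (\<Sum>e = 0..m. real (level_count n E e) / (l - z * real e))"

text \<open>Since \<open>x / 0 = 0\<close>, the poles of \<open>X\<close> have to be excluded explicitly: \<open>X_fun\<close> may
  vanish there by accident.\<close>

definition X_roots :: "nat \<Rightarrow> nat \<Rightarrow> (nat \<Rightarrow> nat) \<Rightarrow> real \<Rightarrow> real set" where
  "X_roots n m E z =
     {l. (\<forall>e\<le>m. level_count n E e > 0 \<longrightarrow> l \<noteq> z * real e) \<and> X_fun n m E z l = 0}"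

definition lambda0 :: "nat \<Rightarrow> nat \<Rightarrow> (nat \<Rightarrow> nat) \<Rightarrow> real \<Rightarrow> real" where
  "lambda0 n m E z = (LEAST l. l \<in> X_roots n m E z)"

definition lambda1 :: "nat \<Rightarrow> nat \<Rightarrow> (nat \<Rightarrow> nat) \<Rightarrow> real \<Rightarrow> real" where
  "lambda1 n m E z = (LEAST l. l \<in> X_roots n m E z \<and> l > lambda0 n m E z)"

definition gap :: "nat \<Rightarrow> nat \<Rightarrow> (nat \<Rightarrow> nat) \<Rightarrow> real \<Rightarrow> real" where
  "gap n m E z = lambda1 n m E z - lambda0 n m E z"


definition gap_root :: "nat \<Rightarrow> nat \<Rightarrow> (nat \<Rightarrow> nat) \<Rightarrow> real \<Rightarrow> real" where
  "gap_root n m E z =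
     sqrt ((z - Z_moment n m E 1)\<^sup>2
           + 4 * (real (level_count n E 0) / 2 ^ n) * Z_moment n m E 2)"

definition lambda0_approx :: "nat \<Rightarrow> nat \<Rightarrow> (nat \<Rightarrow> nat) \<Rightarrow> real \<Rightarrow> real" where
  "lambda0_approx n m E z =
     z * ((z - Z_moment n m E 1 - gap_root n m E z) / (2 * Z_moment n m E 2))"

definition lambda1_approx :: "nat \<Rightarrow> nat \<Rightarrow> (nat \<Rightarrow> nat) \<Rightarrow> real \<Rightarrow> real" where
  "lambda1_approx n m E z =
     z * ((z - Z_moment n m E 1 + gap_root n m E z) / (2 * Z_moment n m E 2))"

definition gap_approx :: "nat \<Rightarrow> nat \<Rightarrow> (nat \<Rightarrow> nat) \<Rightarrow> real \<Rightarrow> real" where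
  "gap_approx n m E z = lambda1_approx n m E z - lambda0_approx n m E z"

definition z_lower :: "nat \<Rightarrow> nat \<Rightarrow> (nat \<Rightarrow> nat) \<Rightarrow> real \<Rightarrow> real" where
  "z_lower n m E d = Z_moment n m E 1 - (Z_moment n m E 2)\<^sup>2 / Z_moment n m E 3 * d"

definition z_upper :: "nat \<Rightarrow> nat \<Rightarrow> (nat \<Rightarrow> nat) \<Rightarrow> real \<Rightarrow> real" where
  "z_upper n m E d = Z_moment n m E 1 + (Z_moment n m E 2)\<^sup>2 / Z_moment n m E 3 * d"


text \<open>Polynomially bounded functions of \<open>n\<close>. They serve as the bound \<open>m = poly(n)\<close> and as the
  constants of \<open>O\<close>-estimates in which non-exponential factors are omitted: \<open>f = O(h)\<close> means
  \<open>|f| \<le> K n * h\<close> with polynomially bounded \<open>K\<close>, uniformly over all instances.\<close>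

definition poly_bounded :: "(nat \<Rightarrow> real) \<Rightarrow> bool" where
  "poly_bounded f \<longleftrightarrow> (\<exists>C k. \<forall>n\<ge>1. f n \<le> C * real n ^ k)"

end

theory Submission
  imports Defs
begin

text \<open>Write \<open>\<lambda> = z \<mu>\<close>, \<open>n0 = N\<^sub>0 / N\<close> and \<open>F \<mu> = (\<Sum>e\<ge>1. n\<^sub>e / (e - \<mu>))\<close>. Then \<open>X (\<lambda>) = 0\<close> reads
  \<open>z = F \<mu> - n0 / \<mu>\<close>, whose right-hand side increases from \<open>0\<close> to \<open>\<infinity>\<close> for \<open>\<mu> < 0\<close> and from \<open>-\<infinity>\<close> to \<open>\<infinity>\<close>
  between \<open>0\<close> and the lowest excited level. So every \<open>z > 0\<close> has exactly one root \<open>- x < 0\<close> and one root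
  \<open>y > 0\<close> below that level. The approximations replace \<open>F \<mu>\<close> by \<open>Z\<^sub>1 + Z\<^sub>2 \<mu>\<close>; the errors come from the
  Taylor remainder of \<open>F\<close>.

  For the minimal gap, eliminate \<open>z\<close>: with \<open>D\<^sub>e = (e + x) (e - y)\<close>, the two root equations are
  equivalent to \<open>n0 = x y S\<close> and \<open>z = T\<close>, where \<open>S = (\<Sum>e. n\<^sub>e / D\<^sub>e)\<close> and
  \<open>T = (\<Sum>e. n\<^sub>e e / D\<^sub>e)\<close>, and the gap is \<open>(x + y) T\<close>. As \<open>(x + y)\<^sup>2 = (x - y)\<^sup>2 + 4 n0 / S\<close>,
  comparing a minimizer with the point \<open>x = y\<close> forces \<open>x - y = O(n0)\<close>, and both estimates follow.\<close>

section \<open>Quadratic equations in the divided form of the truncated secular equation\<close>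

lemma quadratic_root_upper:
  fixes B A y k :: real
  assumes "0 < B" "0 < A" "0 < y" "0 < k" "B * y - k / y \<le> B * A"
  shows "y \<le> A + k / (B * A)"
proof (cases "y \<le> A")
  case True
  then show ?thesis using assms by (simp add: add_increasing2)
next
  case False
  then have "k / y \<le> k / A" using assms by (intro divide_left_mono) auto
  then have "B * y \<le> B * (A + k / (B * A))" using assms by (simp add: algebra_simps)
  then show ?thesis using assms by simp
qed

text \<open>Dividing \<open>B x^2 + a x - k = 0\<close> by \<open>x\<close> gives the shape of the
  secular equation with \<open>F\<close> linearised. For \<open>a = z - Z 1\<close> and
  \<open>a = Z 1 - z\<close> this is the absolute value of the approximate negative and positive
  root, in units of \<open>z\<close>.\<close>

lemma quadratic_root:
  fixes a k B :: real
  assumes "0 < B" "0 < k"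
  defines "x \<equiv> (sqrt (a\<^sup>2 + 4 * k * B) - a) / (2 * B)"
  shows "0 < x" "B * x - k / x = - a"
proof -
  define r where "r = sqrt (a\<^sup>2 + 4 * k * B)"
  have p: "0 < 4 * k * B" using assms by simp
  have r2: "r\<^sup>2 = a\<^sup>2 + 4 * k * B" using p by (simp add: r_def add_nonneg_pos less_imp_le)
  have "\<bar>a\<bar> < r" unfolding r_def using p real_sqrt_less_mono[of "a\<^sup>2" "a\<^sup>2 + 4 * k * B"] by simp
  then have ra: "0 < r - a" by simp
  have x_eq: "x = (r - a) / (2 * B)" by (simp add: x_def r_def)
  show x: "0 < x" using ra assms(1) by (simp add: x_eq)
  have "x * (B * x + a) = k"
  proof -
    have "B * x + a = (r + a) / 2" using assms(1) by (simp add: x_eq field_simps)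
    then have "x * (B * x + a) = (r - a) / (2 * B) * ((r + a) / 2)" by (simp only: x_eq)
    also have "\<dots> = (r\<^sup>2 - a\<^sup>2) / (4 * B)" by (simp add: power2_eq_square algebra_simps)
    finally have "x * (B * x + a) = (r\<^sup>2 - a\<^sup>2) / (4 * B)" .
    then show ?thesis using r2 assms(1) by simp
  qed
  then have "k / x = B * x + a" using x by (metis nonzero_mult_div_cancel_left less_irrefl)
  then show "B * x - k / x = - a" by simp
qed

section \<open>The two lowest roots of the secular equation\<close>

text \<open>The secular equation depends only on the level densities, so it is studied for positive
  weights on a finite set of levels. \<open>M\<close> bounds the levels and supplies all polynomial
  factors.\<close>

locale level_weights =
  fixes L :: "nat set" and w :: "nat \<Rightarrow> real" and n0 M :: real
  assumes finite_L: "finite L" and L_ne: "L \<noteq> {}"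
    and w_pos: "\<And>e. e \<in> L \<Longrightarrow> 0 < w e"
    and L_ge: "\<And>e. e \<in> L \<Longrightarrow> 1 \<le> real e"
    and L_le: "\<And>e. e \<in> L \<Longrightarrow> real e \<le> M"
    and n0_pos: "0 < n0"
    and total: "n0 + (\<Sum>e\<in>L. w e) = 1"
begin

definition Z :: "nat \<Rightarrow> real" where "Z p = (\<Sum>e\<in>L. w e / real e ^ p)"
definition F :: "real \<Rightarrow> real" where "F t = (\<Sum>e\<in>L. w e / (real e - t))"
definition lowest :: real where "lowest = real (Min L)"
definition S :: "real \<Rightarrow> real \<Rightarrow> real"
  where "S x y = (\<Sum>e\<in>L. w e / ((real e + x) * (real e - y)))"
definition T :: "real \<Rightarrow> real \<Rightarrow> real"
  where "T x y = (\<Sum>e\<in>L. w e * real e / ((real e + x) * (real e - y)))"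

lemma lowest_in: "Min L \<in> L" using finite_L L_ne by simp
lemma lowest_le: "e \<in> L \<Longrightarrow> lowest \<le> real e" using finite_L by (simp add: lowest_def)
lemma lowest_ge: "1 \<le> lowest" using L_ge[OF lowest_in] by (simp add: lowest_def)
lemma w_nonneg: "e \<in> L \<Longrightarrow> 0 \<le> w e" using w_pos by force
lemma M_ge: "1 \<le> M" using L_ge[OF lowest_in] L_le[OF lowest_in] by linarith
lemma L_pos: "e \<in> L \<Longrightarrow> 0 < real e" using L_ge[of e] by linarith

section \<open>Bounds on the moments\<close>

lemma Z_pos: "0 < Z p"
  unfolding Z_def using w_pos L_pos finite_L L_ne by (intro sum_pos) auto

lemma n0_lt_1: "n0 < 1"
  using sum_pos[OF finite_L L_ne, of w] w_pos total by force

lemma Z_0: "Z 0 = 1 - n0" using total by (simp add: Z_def)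

lemma Z_Suc_le: "Z (Suc p) \<le> Z p"
  unfolding Z_def
proof (rule sum_mono)
  fix e assume e: "e \<in> L"
  have "real e ^ p \<le> real e ^ Suc p" using L_ge[OF e] by simp
  then show "w e / real e ^ Suc p \<le> w e / real e ^ p"
    using w_nonneg[OF e] L_pos[OF e] by (intro divide_left_mono) auto
qed

lemma Z_le_M_Z_Suc: "Z p \<le> M * Z (Suc p)"
  unfolding Z_def sum_distrib_left
proof (rule sum_mono)
  fix e assume e: "e \<in> L"
  have "w e / real e ^ p = real e * (w e / real e ^ Suc p)" using L_pos[OF e] by simp
  also have "\<dots> \<le> M * (w e / real e ^ Suc p)"
    using w_nonneg[OF e] L_le[OF e] by (intro mult_right_mono) auto
  finally show "w e / real e ^ p \<le> M * (w e / real e ^ Suc p)" .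
qed

lemma Z_le_1: "Z p \<le> 1"
  by (induction p) (use Z_0 n0_pos Z_Suc_le in \<open>auto intro: order_trans\<close>)

text \<open>Starting from \<open>Z 0 = 1 - n0\<close>, each further division by a level costs at
  most a factor \<open>M\<close>. This makes \<open>1 / Z p\<close> a non-exponential
  factor.\<close>

lemma Z_ge:
  assumes "n0 \<le> 1 / 2"
  shows "1 \<le> 2 * M ^ p * Z p"
proof (induction p)
  case 0
  then show ?case using assms Z_0 by simp
next
  case (Suc p)
  have "2 * M ^ p * Z p \<le> 2 * M ^ p * (M * Z (Suc p))"
    using Z_le_M_Z_Suc[of p] M_ge by (intro mult_left_mono) auto
  then show ?case using Suc by (simp add: algebra_simps)
qed

section \<open>Existence, uniqueness and continuity of the two roots\<close>

lemma F_strict_mono: "s < t \<Longrightarrow> t < lowest \<Longrightarrow> F s < F t"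
  unfolding F_def
  by (rule sum_strict_mono) (use finite_L L_ne w_pos lowest_le in \<open>force intro!: divide_strict_left_mono\<close>)+

lemma isCont_F: "t < lowest \<Longrightarrow> isCont F t"
  unfolding F_def using lowest_le by (intro continuous_intros) force

lemma F_ge_one_term: "e \<in> L \<Longrightarrow> t < lowest \<Longrightarrow> w e / (real e - t) \<le> F t"
  unfolding F_def using finite_L w_nonneg lowest_le by (intro member_le_sum) force+

lemma ex_root_neg:
  assumes z: "0 < z"
  shows "\<exists>x>0. n0 / x + F (- x) = z"
proof -
  let ?f = "\<lambda>x. n0 / x + F (- x)"
  have c0: "0 < lowest" using lowest_ge by simp
  have F0: "0 \<le> F (- x)" if "0 < x" for x
    unfolding F_def using that w_nonneg by (intro sum_nonneg) auto
  \<comment> \<open>Dropping the levels from the denominators gives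
    \<open>F (- 1 / z) <= (1 - n0) z\<close>, and the ground term contributes exactly
    \<open>n0 z\<close>.\<close>
  have up: "?f (1 / z) \<le> z"
  proof -
    have "F (- (1 / z)) \<le> (\<Sum>e\<in>L. w e * z)"
      unfolding F_def
    proof (rule sum_mono)
      fix e assume e: "e \<in> L"
      have "w e / (real e - - (1 / z)) \<le> w e / (1 / z)"
        using e z w_nonneg L_pos[OF e] by (intro divide_left_mono) (auto intro!: divide_pos_pos add_pos_pos)
      then show "w e / (real e - - (1 / z)) \<le> w e * z" by simp
    qed
    also have "\<dots> = (1 - n0) * z" using total by (simp add: sum_distrib_right[symmetric])
    finally show ?thesis by (simp add: algebra_simps)
  qed
  \<comment> \<open>The ground term alone equals \<open>z\<close> here.\<close>
  have lo: "z \<le> ?f (n0 / z)" using F0[of "n0 / z"] z n0_pos by simp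
  have "\<exists>x\<ge>n0 / z. x \<le> 1 / z \<and> ?f x = z"
  proof (rule IVT2[where f="?f" and a="n0 / z" and b="1 / z", OF up lo])
    show "n0 / z \<le> 1 / z" using n0_lt_1 z by (simp add: divide_right_mono)
    have p: "0 < n0 / z" using n0_pos z by simp
    show "\<forall>x. n0 / z \<le> x \<and> x \<le> 1 / z \<longrightarrow> isCont ?f x"
    proof (intro allI impI)
      fix x assume "n0 / z \<le> x \<and> x \<le> 1 / z"
      with p have "0 < x" by linarith
      then show "isCont ?f x" using c0
        by (intro continuous_intros isCont_o2[where g=F and f=uminus] isCont_F) auto
    qed
  qed
  then obtain x where "n0 / z \<le> x" "?f x = z" by blast
  moreover have "0 < n0 / z" using n0_pos z by simp
  ultimately show ?thesis by (intro exI[of _ x]) auto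
qed

lemma ex_root_pos:
  assumes z: "0 < z"
  shows "\<exists>y>0. y < lowest \<and> F y - n0 / y = z"
proof -
  let ?f = "\<lambda>y. F y - n0 / y"
  define k where "k = w (Min L)"
  have k: "0 < k" using w_pos lowest_in by (simp add: k_def)
  \<comment> \<open>The first bound keeps \<open>lowest - d\<close> at least \<open>1/2\<close>, so
    the ground term stays below 2; the second makes the lowest level alone contribute at least
    \<open>z + 2\<close>.\<close>
  define d where "d = min (1/2) (k / (z + 2))"
  have d: "0 < d" "d \<le> 1/2" "d \<le> k / (z + 2)" using k z unfolding d_def by (simp, blast intro: min.cobounded1, blast intro: min.cobounded2)
  \<comment> \<open>The ground term is 2 here, and \<open>F\<close> is at most 2 because all its
    denominators exceed \<open>1/2\<close>.\<close>
  have lo: "?f (n0 / 2) \<le> z"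
  proof -
    have "F (n0 / 2) \<le> (\<Sum>e\<in>L. 2 * w e)"
      unfolding F_def
    proof (rule sum_mono)
      fix e assume e: "e \<in> L"
      have "w e / (real e - n0 / 2) \<le> w e / (1/2)"
        using L_ge[OF e] n0_lt_1 w_nonneg[OF e] by (intro divide_left_mono) auto
      then show "w e / (real e - n0 / 2) \<le> 2 * w e" by simp
    qed
    also have "\<dots> \<le> 2" using total n0_pos by (simp add: sum_distrib_left[symmetric])
    finally show ?thesis using n0_pos z by simp
  qed
  have up: "z \<le> ?f (lowest - d)"
  proof -
    have "z + 2 \<le> k / d" using d z by (simp add: field_simps)
    also have "\<dots> \<le> F (lowest - d)"
      using F_ge_one_term[OF lowest_in, of "lowest - d"] d by (simp add: k_def lowest_def)
    finally have 1: "z + 2 \<le> F (lowest - d)" .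
    have "n0 / (lowest - d) \<le> n0 / (1/2)"
      using lowest_ge d n0_pos by (intro divide_left_mono) auto
    then show ?thesis using 1 n0_lt_1 by simp
  qed
  have "\<exists>y\<ge>n0 / 2. y \<le> lowest - d \<and> ?f y = z"
  proof (rule IVT[where f="?f" and a="n0 / 2" and b="lowest - d", OF lo up])
    show "n0 / 2 \<le> lowest - d" using n0_lt_1 lowest_ge d by linarith
    show "\<forall>x. n0 / 2 \<le> x \<and> x \<le> lowest - d \<longrightarrow> isCont ?f x"
      using n0_pos d by (intro allI impI continuous_intros isCont_F) auto
  qed
  then obtain y where "n0 / 2 \<le> y" "y \<le> lowest - d" "?f y = z" by blast
  then show ?thesis using n0_pos d by (intro exI[of _ y]) auto
qed

text \<open>The absolute value of the negative root, so that both roots are positive numbers in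
  units of \<open>z\<close>. Strict monotonicity makes the choice unique.\<close>

definition neg_root :: "real \<Rightarrow> real" where "neg_root z = (SOME x. 0 < x \<and> n0 / x + F (- x) = z)"
definition pos_root :: "real \<Rightarrow> real" where "pos_root z = (SOME y. 0 < y \<and> y < lowest \<and> F y - n0 / y = z)"

lemma neg_root: assumes "0 < z" shows "0 < neg_root z" "n0 / neg_root z + F (- neg_root z) = z"
  using someI_ex[OF ex_root_neg[OF assms]] by (auto simp: neg_root_def)

lemma pos_root: assumes "0 < z" shows "0 < pos_root z" "pos_root z < lowest" "F (pos_root z) - n0 / pos_root z = z"
  using someI_ex[OF ex_root_pos[OF assms]] by (auto simp: pos_root_def)

lemma root_neg_strict: "0 < s \<Longrightarrow> s < t \<Longrightarrow> n0 / t + F (- t) < n0 / s + F (- s)"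
  using F_strict_mono[of "- t" "- s"] lowest_ge n0_pos
  by (smt (verit) divide_strict_left_mono mult_pos_pos)

lemma root_pos_strict: "0 < s \<Longrightarrow> s < t \<Longrightarrow> t < lowest \<Longrightarrow> F s - n0 / s < F t - n0 / t"
  using F_strict_mono[of s t] n0_pos
  by (smt (verit) divide_strict_left_mono mult_pos_pos)

lemma root_neg_gt_0: "0 < x \<Longrightarrow> 0 < n0 / x + F (- x)"
  unfolding F_def using n0_pos w_nonneg L_pos by (intro add_pos_nonneg sum_nonneg) (force)+

text \<open>Stated as a left inverse: this form feeds the inverse function theorem and evaluates the
  root at parameters that are given through \<open>x\<close>.\<close>

lemma neg_root_unique: "0 < x \<Longrightarrow> neg_root (n0 / x + F (- x)) = x"
  using neg_root[OF root_neg_gt_0] root_neg_strict by (metis less_irrefl linorder_neqE)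

lemma pos_root_unique: "0 < y \<Longrightarrow> y < lowest \<Longrightarrow> 0 < F y - n0 / y \<Longrightarrow> pos_root (F y - n0 / y) = y"
  using pos_root root_pos_strict by (metis less_irrefl linorder_neqE)

lemma isCont_neg_root:
  assumes z: "0 < z" shows "isCont neg_root z"
proof -
  let ?f = "\<lambda>x. n0 / x + F (- x)" let ?x = "neg_root z"
  have "isCont neg_root (?f ?x)"
  proof (rule isCont_inverse_function[where d="?x / 2" and f="?f" and x="?x"])
    have pos: "0 < t" if "\<bar>t - ?x\<bar> \<le> ?x / 2" for t using that neg_root(1)[OF z] by linarith
    show "0 < ?x / 2" using neg_root[OF z] by simp
    show "neg_root (?f t) = t" if "\<bar>t - ?x\<bar> \<le> ?x / 2" for t using neg_root_unique pos[OF that] .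
    show "isCont ?f t" if "\<bar>t - ?x\<bar> \<le> ?x / 2" for t
      using pos[OF that] lowest_ge
      by (intro continuous_intros isCont_o2[where g=F and f=uminus] isCont_F) auto
  qed
  then show ?thesis using neg_root[OF z] by simp
qed

text \<open>The inverse relation holds only where the secular function is positive and the argument
  lies below the first pole; continuity at the root supplies a neighbourhood with both
  properties.\<close>

lemma isCont_pos_root:
  assumes z: "0 < z" shows "isCont pos_root z"
proof -
  let ?f = "\<lambda>y. F y - n0 / y" let ?y = "pos_root z"
  note y = pos_root[OF z]
  have cont: "isCont ?f t" if "0 < t" "t < lowest" for t
    using that by (intro continuous_intros isCont_F) auto
  have "\<forall>\<^sub>F t in at ?y. 0 < ?f t"
    using cont[OF y(1,2)] y z by (intro order_tendstoD(1)[OF isContD]) auto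
  moreover have "\<forall>\<^sub>F t in at ?y. 0 < t \<and> t < lowest"
    using y by (intro eventually_conj order_tendstoD[OF tendsto_ident_at]) auto
  ultimately have "\<forall>\<^sub>F t in at ?y. 0 < ?f t \<and> 0 < t \<and> t < lowest"
    by (rule eventually_conj)
  then obtain d where d: "0 < d" "\<And>t. t \<noteq> ?y \<Longrightarrow> \<bar>t - ?y\<bar> < d \<Longrightarrow> 0 < ?f t \<and> 0 < t \<and> t < lowest"
    by (auto simp: eventually_at dist_real_def)
  have d': "0 < ?f t \<and> 0 < t \<and> t < lowest" if "\<bar>t - ?y\<bar> < d" for t
    using d(2)[of t] that y z by (cases "t = ?y") auto
  have "isCont pos_root (?f ?y)"
  proof (rule isCont_inverse_function[where d="d / 2" and f="?f" and x="?y"])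
    show "0 < d / 2" using d by simp
    fix t assume "\<bar>t - ?y\<bar> \<le> d / 2"
    then have t: "0 < ?f t \<and> 0 < t \<and> t < lowest" using d' d(1) by auto
    show "pos_root (?f t) = t" using pos_root_unique t by blast
    show "isCont ?f t" using cont t by blast
  qed
  then show ?thesis using y by simp
qed

section \<open>Partial fractions and the parametrisation by root pairs\<close>

lemma F_diff: assumes "0 < x" "0 < y" "y < lowest" shows "F y - F (- x) = (x + y) * S x y"
  unfolding F_def S_def sum_distrib_left sum_subtractf[symmetric]
proof (rule sum.cong)
  fix e assume "e \<in> L"
  with assms lowest_le[of e] L_pos[of e] have "0 < real e - y" "0 < real e + x" by auto
  then show "w e / (real e - y) - w e / (real e - - x) = (x + y) * (w e / ((real e + x) * (real e - y)))"
    by (simp add: divide_simps) (simp add: algebra_simps)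
qed simp

lemma F_comb: assumes "0 < x" "0 < y" "y < lowest" shows "x * F (- x) + y * F y = (x + y) * T x y"
  unfolding F_def T_def sum_distrib_left sum.distrib[symmetric]
proof (rule sum.cong)
  fix e assume "e \<in> L"
  with assms lowest_le[of e] L_pos[of e] have "0 < real e - y" "0 < real e + x" by auto
  then show "x * (w e / (real e - - x)) + y * (w e / (real e - y)) = (x + y) * (w e * real e / ((real e + x) * (real e - y)))"
    by (simp add: divide_simps) (simp add: algebra_simps)
qed simp

text \<open>Subtracting the two equations eliminates \<open>z\<close> and leaves
  \<open>n0 / x + n0 / y = (x + y) S\<close>. Weighting them with \<open>x\<close> and
  \<open>y\<close> and adding cancels the ground terms and leaves \<open>T\<close>.\<close>

lemma root_pair:
  assumes "0 < x" "0 < y" "y < lowest" "n0 / x + F (- x) = z" "F y - n0 / y = z"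
  shows "n0 = x * y * S x y" "z = T x y"
proof -
  have p: "0 < x + y" using assms by simp
  have "n0 / x + n0 / y = (x + y) * S x y" using F_diff[OF assms(1-3)] assms(4,5) by linarith
  then have "n0 * (x + y) = (x + y) * (x * y * S x y)" using assms(1,2) by (simp add: field_simps)
  then show "n0 = x * y * S x y" using p by simp
  have "x * (n0 / x + F (- x)) + y * (F y - n0 / y) = (x + y) * T x y"
    using F_comb[OF assms(1-3)] assms(1,2) by (simp add: algebra_simps)
  then have "(x + y) * z = (x + y) * T x y" unfolding assms(4,5) by (simp add: algebra_simps)
  then show "z = T x y" using p by simp
qed

text \<open>The converse allows a pair to be chosen first: every point of the curve
  \<open>n0 = x y S\<close> solves both equations with parameter \<open>T x y\<close>.\<close>

lemma root_pairI:
  assumes "0 < x" "0 < y" "y < lowest" "n0 = x * y * S x y"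
  shows "n0 / x + F (- x) = T x y" "F y - n0 / y = T x y"
proof -
  \<comment> \<open>Termwise this is \<open>y + (e - y) = e\<close> over the common
    denominator.\<close>
  have "y * S x y + F (- x) = T x y"
    unfolding F_def S_def T_def sum_distrib_left sum.distrib[symmetric]
  proof (rule sum.cong)
    fix e assume "e \<in> L"
    with assms lowest_le[of e] L_pos[of e] have "0 < real e - y" "0 < real e + x" by auto
    then show "y * (w e / ((real e + x) * (real e - y))) + w e / (real e - - x) = w e * real e / ((real e + x) * (real e - y))"
      by (simp add: divide_simps) (simp add: algebra_simps)
  qed simp
  moreover have "n0 / x = y * S x y" using assms by (metis nonzero_mult_div_cancel_left less_irrefl mult.assoc)
  ultimately show 1: "n0 / x + F (- x) = T x y" by simp
  have "n0 / y = x * S x y" using assms(2,4) by (metis nonzero_mult_div_cancel_left less_irrefl mult.assoc mult.commute)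
  then show "F y - n0 / y = T x y" using 1 F_diff[OF assms(1-3)] \<open>n0 / x = y * S x y\<close> by (simp add: algebra_simps)
qed

section \<open>Errors of the approximate roots\<close>

lemma Z_antimono: "p \<le> q \<Longrightarrow> Z q \<le> Z p"
  by (rule lift_Suc_antimono_le[of Z, OF Z_Suc_le])

text \<open>With \<open>q = Z 3 / Z 2\<close> and \<open>A = d / q\<close>, the left-hand side is
  the excess \<open>n0 / (Z 2 A)\<close> of an approximate root over \<open>A\<close>. It equals
  \<open>q / Z 2\<close> times \<open>n0 / d\<close>, where \<open>q <= 1\<close> and
  \<open>1 / Z 2 <= 2 M^2\<close>.\<close>

lemma error_const_bound:
  assumes "n0 \<le> 1 / 2" "0 < d"
  shows "n0 / (Z 2 * (d / (Z 3 / Z 2))) \<le> 2 * M\<^sup>2 * (n0 / d)"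
proof -
  have "Z 3 / Z 2 \<le> 1" using Z_antimono[of 2 3] Z_pos[of 2] by simp
  have "Z 3 / Z 2 / Z 2 \<le> 1 / Z 2"
    using \<open>Z 3 / Z 2 \<le> 1\<close> Z_pos[of 2] by (intro divide_right_mono) auto
  also have "\<dots> \<le> 2 * M\<^sup>2" using Z_ge[OF assms(1), of 2] Z_pos[of 2] by (simp add: field_simps)
  finally have "Z 3 / Z 2 / Z 2 * (n0 / d) \<le> 2 * M\<^sup>2 * (n0 / d)"
    using n0_pos assms by (intro mult_right_mono) auto
  then show ?thesis using assms Z_pos[of 2] Z_pos[of 3] by (simp add: field_simps)
qed

text \<open>Taylor expansion at 0 with exact remainder, termwise
  \<open>1 / (e + x) = 1 / e - x / e^2 + x^2 / (e^2 (e + x))\<close>. The approximate roots keep the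
  linear part only.\<close>

lemma F_neg_expansion:
  assumes "0 < x"
  shows "F (- x) = Z 1 - Z 2 * x + x\<^sup>2 * (\<Sum>e\<in>L. w e / (real e ^ 2 * (real e + x)))"
  unfolding F_def Z_def sum_distrib_left sum_distrib_right sum.distrib[symmetric] sum_subtractf[symmetric]
proof (rule sum.cong)
  fix e assume "e \<in> L"
  then have "0 < real e" using L_pos by auto
  then show "w e / (real e - - x) = w e / real e ^ 1 - w e / (real e)\<^sup>2 * x + x\<^sup>2 * (w e / ((real e)\<^sup>2 * (real e + x)))"
    using assms by (simp add: divide_simps) (simp add: algebra_simps power2_eq_square)
qed simp

lemma F_pos_expansion:
  assumes "0 < y" "y < lowest"
  shows "F y = Z 1 + Z 2 * y + y\<^sup>2 * (\<Sum>e\<in>L. w e / (real e ^ 2 * (real e - y)))"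
  unfolding F_def Z_def sum_distrib_left sum_distrib_right sum.distrib[symmetric] sum_subtractf[symmetric]
proof (rule sum.cong)
  fix e assume "e \<in> L"
  then have "0 < real e" "0 < real e - y" using L_pos lowest_le[of e] assms by auto
  then show "w e / (real e - y) = w e / real e ^ 1 + w e / (real e)\<^sup>2 * y + y\<^sup>2 * (w e / ((real e)\<^sup>2 * (real e - y)))"
    by (simp add: divide_simps) (simp add: algebra_simps power2_eq_square)
qed simp

text \<open>Jensen's inequality for the concave function \<open>u \<mapsto> u / (1 + x u)\<close> at \<open>u = 1 / e\<close> with weights
  \<open>w e / e\<^sup>2\<close>, proved through the tangent at the mean \<open>Z 3 / Z 2\<close>.\<close>

lemma remainder_jensen:
  assumes "0 < x"
  shows "(\<Sum>e\<in>L. w e / (real e ^ 2 * (real e + x))) \<le> Z 3 / (1 + Z 3 / Z 2 * x)"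
proof -
  define q where "q = Z 3 / Z 2"
  define k where "k = 1 + q * x"
  have q: "0 < q" using Z_pos by (simp add: q_def)
  have k: "1 < k" using q assms by (simp add: k_def)
  have "(\<Sum>e\<in>L. w e / (real e ^ 2 * (real e + x)))
      \<le> (\<Sum>e\<in>L. w e / real e ^ 2 * (q / k - q / k\<^sup>2) + w e / real e ^ 3 * (1 / k\<^sup>2))"
  proof (rule sum_mono)
    fix e assume e: "e \<in> L"
    define u where "u = 1 / real e"
    have u: "0 < u" using L_pos[OF e] by (simp add: u_def)
    have ux: "0 < 1 + x * u" using u assms by (simp add: add_pos_pos)
    have "u * k\<^sup>2 \<le> (q * k + u - q) * (1 + x * u)"
    proof -
      \<comment> \<open>Tangent minus curve, cleared of denominators, is a square times
        \<open>x\<close>.\<close>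
      have "(q * k + u - q) * (1 + x * u) - u * k\<^sup>2 = x * (q - u)\<^sup>2"
        unfolding k_def by (simp add: algebra_simps power2_eq_square)
      moreover have "0 \<le> x * (q - u)\<^sup>2" using assms by simp
      ultimately show ?thesis by linarith
    qed
    then have "u / (1 + x * u) \<le> (q * k + u - q) / k\<^sup>2"
      using ux k by (simp add: divide_simps)
    also have "\<dots> = (q / k - q / k\<^sup>2) + u * (1 / k\<^sup>2)"
      using k by (simp add: divide_simps power2_eq_square)
    finally have "w e / real e ^ 2 * (u / (1 + x * u)) \<le> w e / real e ^ 2 * ((q / k - q / k\<^sup>2) + u * (1 / k\<^sup>2))"
      using w_nonneg[OF e] by (intro mult_left_mono) auto
    moreover have "w e / real e ^ 2 * (u / (1 + x * u)) = w e / (real e ^ 2 * (real e + x))"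
      using L_pos[OF e] assms by (simp add: u_def divide_simps)
    moreover have "w e / real e ^ 2 * ((q / k - q / k\<^sup>2) + u * (1 / k\<^sup>2)) =
        w e / real e ^ 2 * (q / k - q / k\<^sup>2) + w e / real e ^ 3 * (1 / k\<^sup>2)"
      by (simp only: distrib_left) (simp add: u_def power2_eq_square power3_eq_cube)
    ultimately show "w e / (real e ^ 2 * (real e + x)) \<le> w e / real e ^ 2 * (q / k - q / k\<^sup>2) + w e / real e ^ 3 * (1 / k\<^sup>2)"
      by simp
  qed
  also have "\<dots> = Z 2 * (q / k - q / k\<^sup>2) + Z 3 * (1 / k\<^sup>2)"
    unfolding Z_def by (simp only: sum.distrib sum_distrib_right)
  \<comment> \<open>Since \<open>Z 2 q = Z 3\<close>, the two terms with \<open>1 / k^2\<close>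
    cancel: \<open>q\<close> is the mean.\<close>
  also have "\<dots> = Z 3 / k"
    using Z_pos[of 2] k by (simp add: q_def algebra_simps)
  finally show ?thesis unfolding k_def q_def .
qed

text \<open>Comparing the quadratic equation with the exact one gives
  \<open>Z 2 (x - x') + n0 (x - x') / (x x') = x^2 Q\<close>, hence \<open>x' <= x\<close>. Jensen's
  bound on \<open>Q\<close> makes the relative error at most \<open>q x'\<close>, and the assumption
  on \<open>z\<close> bounds \<open>x'\<close> by \<open>d / q\<close> plus a term in
  \<open>n0 / d\<close>.\<close>

lemma approx_root_neg_error:
  assumes n0: "n0 \<le> 1 / 2" and d: "0 < d" and x: "0 < x" and z: "n0 / x + F (- x) = z"
    and x': "0 < x'" "Z 2 * x' - n0 / x' = Z 1 - z"
    and le: "Z 1 - (Z 2)\<^sup>2 / Z 3 * d \<le> z"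
  shows "\<bar>(x - x') / x\<bar> \<le> d + 2 * M\<^sup>2 * (n0 / d)"
proof -
  define Q where "Q = (\<Sum>e\<in>L. w e / (real e ^ 2 * (real e + x)))"
  define q where "q = Z 3 / Z 2"
  have q: "0 < q" using Z_pos by (simp add: q_def)
  have Z2: "0 < Z 2" using Z_pos .
  have Q0: "0 \<le> Q" unfolding Q_def using w_nonneg x by (intro sum_nonneg) auto
  have Q1: "Q \<le> Z 3 / (1 + q * x)" unfolding Q_def q_def by (rule remainder_jensen[OF x])
  have qx: "0 < 1 + q * x" using q x by (simp add: add_pos_pos)
  have eq: "Z 2 * (x - x') + n0 * (x - x') / (x * x') = x\<^sup>2 * Q"
  proof -
    have "n0 / x' - n0 / x = n0 * (x - x') / (x * x')" using x x' by (simp add: field_simps)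
    moreover have "n0 / x + Z 1 - Z 2 * x + x\<^sup>2 * Q = z"
      using z F_neg_expansion[OF x] by (simp add: Q_def)
    ultimately show ?thesis using x'(2) by (simp add: algebra_simps)
  qed
  have le': "x' \<le> x"
  proof (rule ccontr)
    assume "\<not> x' \<le> x"
    then have "Z 2 * (x - x') < 0" "n0 * (x - x') / (x * x') < 0"
      using Z2 n0_pos x x' by (auto intro!: mult_pos_neg divide_neg_pos)
    moreover have "0 \<le> x\<^sup>2 * Q" using Q0 by simp
    ultimately show False using eq by linarith
  qed
  have "Z 2 * (x - x') \<le> x\<^sup>2 * Q"
    proof -
      have "0 \<le> n0 * (x - x') / (x * x')" using le' n0_pos x x' by simp
      then show ?thesis using eq by linarith
    qed
  also have "\<dots> \<le> x\<^sup>2 * (Z 3 / (1 + q * x))" using Q1 by (intro mult_left_mono) auto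
  also have "\<dots> = Z 2 * (q * x\<^sup>2 / (1 + q * x))" using Z2 by (simp add: q_def)
  finally have "x - x' \<le> q * x\<^sup>2 / (1 + q * x)" using Z2 by (simp only: mult_le_cancel_left_pos)
  \<comment> \<open>Expanding cancels \<open>q x^2\<close> and leaves \<open>q x x'\<close>. The
    cruder bound \<open>Q <= Z 3\<close> would leave the exact root in place of
    \<open>x'\<close>.\<close>
  then have "(x - x') * (1 + q * x) \<le> q * x\<^sup>2" using qx by (simp add: pos_le_divide_eq)
  then have "x - x' \<le> q * x' * x" by (simp add: algebra_simps power2_eq_square)
  then have "(x - x') / x \<le> q * x'" using x by (simp add: divide_simps)
  \<comment> \<open>No square root is estimated: if a root exceeds \<open>A\<close>, its ground term
    is at most \<open>n0 / A\<close>.\<close>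
  also have "x' \<le> d / q + n0 / (Z 2 * (d / q))"
  proof (rule quadratic_root_upper)
    have "(Z 2)\<^sup>2 / Z 3 * d = Z 2 * (d / q)" using Z2 Z_pos[of 3] by (simp add: q_def power2_eq_square)
    then show "Z 2 * x' - n0 / x' \<le> Z 2 * (d / q)" using le x' by linarith
  qed (use Z2 d q x' n0_pos in auto)
  then have "q * x' \<le> q * (d / q + n0 / (Z 2 * (d / q)))" using q by (intro mult_left_mono) auto
  also have "\<dots> = d + q * (n0 / (Z 2 * (d / q)))" using q by (simp add: algebra_simps)
  also have "\<dots> \<le> d + 1 * (n0 / (Z 2 * (d / q)))"
    using Z_antimono[of 2 3] Z2 q d n0_pos
    by (intro add_left_mono mult_right_mono) (auto simp: q_def intro!: divide_nonneg_pos mult_nonneg_nonneg less_imp_le[OF Z_pos])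
  also have "\<dots> \<le> d + 2 * M\<^sup>2 * (n0 / d)" using error_const_bound[OF n0 d] by (simp add: q_def)
  finally show ?thesis using le' x by simp
qed

text \<open>The same comparison now gives \<open>y <= y'\<close>. The remainder involves the convex
  function \<open>u / (1 - y u)\<close>, for which Jensen's inequality points the wrong way; a
  cruder bound costs the extra \<open>d^2\<close>.\<close>

lemma approx_root_pos_error:
  assumes n0: "n0 \<le> 1 / 2" and d: "0 < d" and y: "0 < y" "y < lowest" and z: "F y - n0 / y = z"
    and y': "0 < y'" "Z 2 * y' - n0 / y' = z - Z 1"
    and le: "z \<le> Z 1 + (Z 2)\<^sup>2 / Z 3 * d"
  shows "\<bar>(y - y') / y\<bar> \<le> d + 8 * M\<^sup>2 * (d\<^sup>2 + n0 / d)"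
proof -
  define Q where "Q = (\<Sum>e\<in>L. w e / (real e ^ 2 * (real e - y)))"
  define q where "q = Z 3 / Z 2"
  define s where "s = n0 / (Z 2 * (d / q))"
  define A where "A = d / q"
  have q: "0 < q" using Z_pos by (simp add: q_def)
  have Z2: "0 < Z 2" using Z_pos .
  have q1: "q \<le> 1" using Z_antimono[of 2 3] Z2 by (simp add: q_def)
  have s0: "0 < s" using n0_pos Z2 d q by (simp add: s_def)
  have A0: "0 < A" using d q by (simp add: A_def)
  have s1: "s \<le> 2 * M\<^sup>2 * (n0 / d)" using error_const_bound[OF n0 d] by (simp add: q_def s_def)
  have A1: "A \<^sup>2 \<le> M\<^sup>2 * d\<^sup>2"
  proof -
    have "Z 2 \<le> M * Z 3" using Z_le_M_Z_Suc[of 2] by simp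
    then have "1 / q \<le> M" using Z2 Z_pos[of 3] by (simp add: q_def divide_simps mult.commute)
    then have "A \<le> M * d" using d mult_right_mono[of "1 / q" M d] by (simp add: A_def)
    then have "A\<^sup>2 \<le> (M * d)\<^sup>2" using A0 by (intro power_mono) auto
    then show ?thesis by (simp add: power_mult_distrib)
  qed
  have ey: "0 < real e - y" if "e \<in> L" for e using lowest_le[OF that] y by simp
  have Q0: "0 \<le> Q" unfolding Q_def using w_nonneg ey by (intro sum_nonneg divide_nonneg_nonneg mult_nonneg_nonneg) (auto intro: less_imp_le)
  have eq: "Z 2 * (y' - y) + n0 * (y' - y) / (y * y') = y\<^sup>2 * Q"
  proof -
    have "n0 / y - n0 / y' = n0 * (y' - y) / (y * y')" using y y' by (simp add: field_simps)
    moreover have "Z 1 + Z 2 * y + y\<^sup>2 * Q - n0 / y = z"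
      using z F_pos_expansion[OF y] by (simp add: Q_def)
    ultimately show ?thesis using y'(2) by (simp add: algebra_simps)
  qed
  have le': "y \<le> y'"
  proof (rule ccontr)
    assume "\<not> y \<le> y'"
    then have "Z 2 * (y' - y) < 0" "n0 * (y' - y) / (y * y') < 0"
      using Z2 n0_pos y y' by (auto intro!: mult_pos_neg divide_neg_pos)
    moreover have "0 \<le> y\<^sup>2 * Q" using Q0 by simp
    ultimately show False using eq by linarith
  qed
  have up: "y' \<le> A + s"
    unfolding A_def s_def
  proof (rule quadratic_root_upper)
    have "(Z 2)\<^sup>2 / Z 3 * d = Z 2 * (d / q)" using Z2 Z_pos[of 3] by (simp add: q_def power2_eq_square)
    then show "Z 2 * y' - n0 / y' \<le> Z 2 * (d / q)" using le y' by linarith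
  qed (use Z2 d q y' n0_pos in auto)
  \<comment> \<open>For \<open>y <= 1/2\<close> the remainder is expanded once more and the error is
    at most \<open>q y + 2 y^2\<close>. For larger \<open>y\<close> the bound
    \<open>y' / y <= 2 (A + s)\<close> suffices, since then \<open>A\<close> or \<open>s\<close>
    exceeds \<open>1/4\<close>.\<close>
  have "(y' - y) / y \<le> d + 8 * A\<^sup>2 + 4 * s"
  proof (cases "y \<le> 1/2")
    case True
    have "Q \<le> (\<Sum>e\<in>L. w e / real e ^ 3 + 2 * y * (w e / real e ^ 4))"
      unfolding Q_def
    proof (rule sum_mono)
      fix e assume e: "e \<in> L"
      let ?e = "real e"
      \<comment> \<open>The right-hand side exceeds \<open>e^2\<close> by
        \<open>y (e - 2 y)\<close>, which is where \<open>y <= 1/2\<close> enters.\<close>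
      have "?e\<^sup>2 \<le> (?e + 2 * y) * (?e - y)"
      proof -
        have "y * (2 * y) \<le> y * ?e" using True L_ge[OF e] y by (intro mult_left_mono) auto
        then show ?thesis by (simp add: algebra_simps power2_eq_square)
      qed
      then have "1 / (?e - y) \<le> (?e + 2 * y) / ?e\<^sup>2"
        using ey[OF e] L_pos[OF e] by (simp add: divide_simps)
      then have "w e / ?e\<^sup>2 * (1 / (?e - y)) \<le> w e / ?e\<^sup>2 * ((?e + 2 * y) / ?e\<^sup>2)"
        using w_nonneg[OF e] by (intro mult_left_mono) auto
      also have "\<dots> = w e / ?e ^ 3 + 2 * y * (w e / ?e ^ 4)"
        using L_pos[OF e] by (simp add: field_simps eval_nat_numeral)
      finally show "w e / (?e\<^sup>2 * (?e - y)) \<le> w e / ?e ^ 3 + 2 * y * (w e / ?e ^ 4)" by simp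
    qed
    also have "\<dots> = Z 3 + 2 * y * Z 4" by (simp add: Z_def sum.distrib sum_distrib_left)
    also have "\<dots> \<le> Z 2 * (q + 2 * y)"
      using Z_antimono[of 2 4] y Z2 by (simp add: q_def algebra_simps)
    finally have "y\<^sup>2 * Q \<le> y\<^sup>2 * (Z 2 * (q + 2 * y))" by (intro mult_left_mono) auto
    moreover have "Z 2 * (y' - y) \<le> y\<^sup>2 * Q"
    proof -
      have "0 \<le> n0 * (y' - y) / (y * y')" using le' n0_pos y y' by simp
      then show ?thesis using eq by linarith
    qed
    ultimately have "Z 2 * (y' - y) \<le> Z 2 * (y\<^sup>2 * (q + 2 * y))" by (simp add: algebra_simps)
    then have "(y' - y) \<le> y\<^sup>2 * (q + 2 * y)" using Z2 by simp
    then have "(y' - y) / y \<le> y * (q + 2 * y)"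
      using y by (simp add: pos_divide_le_eq power2_eq_square mult_ac)
    also have "\<dots> = q * y + 2 * y\<^sup>2" by (simp add: algebra_simps power2_eq_square)
    also have "q * y \<le> q * (A + s)" using up le' q by (intro mult_left_mono) auto
    also have "q * (A + s) \<le> d + s"
      using q q1 s0 mult_right_mono[of q 1 s] by (simp add: A_def algebra_simps)
    \<comment> \<open>Either \<open>y <= s\<close> and so \<open>y^2 <= s\<close>, or
      \<open>y - s\<close> lies between 0 and \<open>A\<close> and the cross term
      \<open>2 y s\<close> is at most \<open>s\<close>.\<close>
    also have "y\<^sup>2 \<le> A\<^sup>2 + s"
    proof (cases "y \<le> s")
      case True': True
      have "y * y \<le> 1 * s" using True True' y by (intro mult_mono) auto
      then show ?thesis by (simp add: power2_eq_square add_increasing)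
    next
      case False
      then have "(y - s)\<^sup>2 \<le> A\<^sup>2" using up le' by (intro power_mono) auto
      moreover have "2 * y * s \<le> 1 * s" using True s0 by (intro mult_right_mono) auto
      ultimately show ?thesis by (simp add: power2_eq_square algebra_simps) (smt (verit) zero_le_square)
    qed
    finally have "(y' - y) / y \<le> d + s + 2 * (A\<^sup>2 + s)" by simp
    also have "\<dots> \<le> d + 8 * A\<^sup>2 + 4 * s" using s0 by simp
    finally show ?thesis .
  next
    case False
    have "(y' - y) / y \<le> y' / y" using y by (intro divide_right_mono) auto
    also have "\<dots> \<le> y' / (1/2)" using False y' y by (intro divide_left_mono) auto
    also have "\<dots> \<le> 2 * (A + s)" using up by simp
    also have "A \<le> 4 * A\<^sup>2 + s"
    proof (cases "A \<le> 1/4")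
      case True
      then have "A \<le> s" using False up le' by linarith
      then show ?thesis by (simp add: add_increasing)
    next
      case False
      then have "A * 1 \<le> A * (4 * A)" using A0 by (intro mult_left_mono) auto
      then show ?thesis using s0 by (simp add: power2_eq_square)
    qed
    finally show ?thesis using d by simp
  qed
  also have "\<dots> \<le> d + 8 * M\<^sup>2 * (d\<^sup>2 + n0 / d)"   proof -
    have "8 * M\<^sup>2 * (d\<^sup>2 + n0 / d) = 8 * (M\<^sup>2 * d\<^sup>2) + 4 * (2 * M\<^sup>2 * (n0 / d))"
      by (simp add: algebra_simps)
    then show ?thesis using A1 s1 by linarith
  qed
  finally show ?thesis using le' y by (simp add: abs_minus_commute)
qed

section \<open>The minimal gap\<close>

lemma denom_bounds:
  assumes "e \<in> L" "0 < x" "x \<le> 1/4" "0 < y" "y \<le> 1/4"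
  shows "real e ^ 2 \<le> 2 * ((real e + x) * (real e - y))" "(real e + x) * (real e - y) \<le> 2 * real e ^ 2"
    "0 < (real e + x) * (real e - y)"
proof -
  have e: "1 \<le> real e" using L_ge assms(1) by auto
  have "real e * (real e / 2) \<le> (real e + x) * (real e - y)"
    using e assms by (intro mult_mono) auto
  then show 1: "real e ^ 2 \<le> 2 * ((real e + x) * (real e - y))" by (simp add: power2_eq_square)
  have "(real e + x) * (real e - y) \<le> (2 * real e) * real e"
    using e assms by (intro mult_mono) auto
  then show "(real e + x) * (real e - y) \<le> 2 * real e ^ 2" by (simp add: power2_eq_square)
  show "0 < (real e + x) * (real e - y)" using e assms by (intro mult_pos_pos) auto
qed

text \<open>Termwise, \<open>e^2 - (e + x) (e - y) = x y - e (x - y)\<close>. The deviations from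
  the moments are of first order in \<open>x - y\<close> but of second order on the diagonal, so
  \<open>x y\<close> and \<open>x - y\<close> are kept apart.\<close>

lemma
  assumes xy: "0 < x" "x \<le> 1/4" "0 < y" "y \<le> 1/4"
  shows T_dev: "\<bar>T x y - Z 1\<bar> \<le> 2 * (x * y + \<bar>x - y\<bar>)"
    and S_dev: "\<bar>S x y - Z 2\<bar> \<le> 2 * (x * y + \<bar>x - y\<bar>)"
proof -
  define h where "h = x * y + \<bar>x - y\<bar>"
  have h: "0 \<le> h" using xy by (simp add: h_def)
  have sumw: "(\<Sum>e\<in>L. 2 * h * w e) \<le> 2 * h"
    using h total n0_pos mult_left_mono[of "\<Sum>e\<in>L. w e" 1 "2 * h"]
    by (simp add: sum_distrib_left[symmetric])
  have abs_frac: "\<bar>a * (b / d * (1 / k))\<bar> = a * (\<bar>b\<bar> / d * (1 / k))"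
    if "0 < a" "0 < d" "0 < k" for a b d k :: real
    using that by (simp add: abs_mult)
  \<comment> \<open>One estimate serves both sums; the terms of \<open>S\<close> carry a further
    factor \<open>1 / e <= 1\<close>.\<close>
  have key: "\<bar>x * y - real e * (x - y)\<bar> / ((real e + x) * (real e - y)) * (1 / real e) \<le> 2 * h"
    if "e \<in> L" for e
  proof -
    let ?D = "(real e + x) * (real e - y)"
    have e: "1 \<le> real e" using L_ge that by auto
    have D: "0 < ?D" "real e ^ 2 \<le> 2 * ?D" using denom_bounds[OF that xy] by auto
    have "\<bar>x * y - real e * (x - y)\<bar> \<le> x * y + real e * \<bar>x - y\<bar>"
      using xy e abs_triangle_ineq4[of "x * y" "real e * (x - y)"] by (simp add: abs_mult)
    also have "\<dots> \<le> real e * (x * y) + real e * \<bar>x - y\<bar>"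
      using e xy mult_right_mono[of 1 "real e" "x * y"] by simp
    also have "\<dots> = real e * h" by (simp add: h_def algebra_simps)
    finally have "\<bar>x * y - real e * (x - y)\<bar> / ?D * (1 / real e) \<le> (real e * h) / ?D * (1 / real e)"
      using D e by (intro mult_right_mono divide_right_mono) auto
    also have "\<dots> = h / ?D" using e by simp
    also have "\<dots> \<le> h / (1 / 2)"
    proof (intro divide_left_mono)
      have "1 \<le> real e ^ 2" using e by simp
      then show "1 / 2 \<le> ?D" using D by simp
    qed (use h D in auto)
    finally show ?thesis by simp
  qed
  have "T x y - Z 1 = (\<Sum>e\<in>L. w e * ((x * y - real e * (x - y)) / ((real e + x) * (real e - y)) * (1 / real e)))"
    unfolding T_def Z_def sum_subtractf[symmetric]
  proof (rule sum.cong)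
    fix e assume e: "e \<in> L"
    then have "0 < real e" "0 < real e - y" "0 < real e + x" using L_ge[OF e] xy by auto
    then show "w e * real e / ((real e + x) * (real e - y)) - w e / real e ^ 1 =
        w e * ((x * y - real e * (x - y)) / ((real e + x) * (real e - y)) * (1 / real e))"
      by (simp add: divide_simps) (simp add: algebra_simps)
  qed simp
  also have "\<bar>\<dots>\<bar> \<le> (\<Sum>e\<in>L. 2 * h * w e)"
  proof (rule order_trans[OF sum_abs sum_mono])
    fix e assume e: "e \<in> L"
    have "\<bar>w e * ((x * y - real e * (x - y)) / ((real e + x) * (real e - y)) * (1 / real e))\<bar> =
       w e * (\<bar>x * y - real e * (x - y)\<bar> / ((real e + x) * (real e - y)) * (1 / real e))"
      by (rule abs_frac[OF w_pos[OF e] denom_bounds(3)[OF e xy] L_pos[OF e]])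
    also have "\<dots> \<le> w e * (2 * h)" using key[OF e] w_nonneg[OF e] by (intro mult_left_mono)
    finally show "\<bar>w e * ((x * y - real e * (x - y)) / ((real e + x) * (real e - y)) * (1 / real e))\<bar> \<le> 2 * h * w e"
      by (simp add: mult.commute)
  qed
  finally show "\<bar>T x y - Z 1\<bar> \<le> 2 * (x * y + \<bar>x - y\<bar>)" using sumw by (simp add: h_def)
  have "S x y - Z 2 = (\<Sum>e\<in>L. w e * ((x * y - real e * (x - y)) / ((real e + x) * (real e - y)) * (1 / real e)) / real e)"
    unfolding S_def Z_def sum_subtractf[symmetric]
  proof (rule sum.cong)
    fix e assume e: "e \<in> L"
    then have "0 < real e" "0 < real e - y" "0 < real e + x" using L_ge[OF e] xy by auto
    then show "w e / ((real e + x) * (real e - y)) - w e / (real e)\<^sup>2 =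
        w e * ((x * y - real e * (x - y)) / ((real e + x) * (real e - y)) * (1 / real e)) / real e"
      by (simp add: divide_simps power2_eq_square) (simp add: algebra_simps)
  qed simp
  also have "\<bar>\<dots>\<bar> \<le> (\<Sum>e\<in>L. 2 * h * w e)"
  proof (rule order_trans[OF sum_abs sum_mono])
    fix e assume e: "e \<in> L"
    have "\<bar>w e * ((x * y - real e * (x - y)) / ((real e + x) * (real e - y)) * (1 / real e)) / real e\<bar> =
       w e * (\<bar>x * y - real e * (x - y)\<bar> / ((real e + x) * (real e - y)) * (1 / real e)) / real e"
      by (subst abs_divide, subst abs_frac[OF w_pos[OF e] denom_bounds(3)[OF e xy] L_pos[OF e]]) simp
    also have "\<dots> \<le> w e * (2 * h) / real e"
      using key[OF e] w_nonneg[OF e] by (intro divide_right_mono mult_left_mono) auto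
    also have "\<dots> \<le> w e * (2 * h) / 1"
      using L_ge[OF e] w_nonneg[OF e] h by (intro divide_left_mono) auto
    finally show "\<bar>w e * ((x * y - real e * (x - y)) / ((real e + x) * (real e - y)) * (1 / real e)) / real e\<bar> \<le> 2 * h * w e"
      by (simp add: mult.commute)
  qed
  finally show "\<bar>S x y - Z 2\<bar> \<le> 2 * (x * y + \<bar>x - y\<bar>)" using sumw by (simp add: h_def)
qed

lemma Z_2_le_S:
  assumes xy: "0 < x" "x \<le> 1/4" "0 < y" "y \<le> 1/4"
  shows "Z 2 \<le> 2 * S x y"
  unfolding Z_def S_def sum_distrib_left
proof (rule sum_mono)
  fix e assume e: "e \<in> L"
  let ?D = "(real e + x) * (real e - y)"
  have "w e / (real e ^ 2) \<le> w e / (?D / 2)"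
    using denom_bounds[OF e xy] w_nonneg[OF e] L_pos[OF e]
    by (intro divide_left_mono) (auto intro!: mult_pos_pos)
  then show "w e / (real e)\<^sup>2 \<le> 2 * (w e / ?D)" by (simp add: mult.commute)
qed

lemma
  assumes xy: "0 < x" "x \<le> 1/4" "0 < y" "y \<le> 1/4"
  shows T_ge: "Z 1 \<le> 2 * T x y" and T_le: "T x y \<le> 2 * Z 1"
proof -
  have *: "w e / real e ^ 1 \<le> 2 * (w e * real e / ((real e + x) * (real e - y))) \<and>
      w e * real e / ((real e + x) * (real e - y)) \<le> 2 * (w e / real e ^ 1)" if e: "e \<in> L" for e
  proof -
    have "w e * real e / (2 * real e ^ 2) \<le> w e * real e / ((real e + x) * (real e - y))"
      "w e * real e / ((real e + x) * (real e - y)) \<le> w e * real e / (real e ^ 2 / 2)"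
      using denom_bounds[OF e xy] w_nonneg[OF e] L_pos[OF e]
      by (intro divide_left_mono; auto intro!: mult_pos_pos)+
    moreover have "w e * real e / (2 * real e ^ 2) = (w e / real e ^ 1) / 2"
      "w e * real e / (real e ^ 2 / 2) = 2 * (w e / real e ^ 1)"
      using L_pos[OF e] by (auto simp: power2_eq_square)
    moreover have "q \<le> 2 * t \<and> t \<le> 2 * q" if "a \<le> t" "t \<le> b" "a = q / 2" "b = 2 * q" for a b q t :: real
      using that by auto
    ultimately show ?thesis by blast
  qed
  show "Z 1 \<le> 2 * T x y" "T x y \<le> 2 * Z 1"
    unfolding Z_def T_def sum_distrib_left using * by (intro sum_mono; blast)+
qed

text \<open>\<open>x y\<close> is \<open>n0 / S\<close>, and \<open>S\<close> is at least half of
  \<open>Z 2\<close>, which is at least \<open>1 / (2 M^2)\<close>.\<close>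

lemma root_product_le:
  assumes n0: "n0 \<le> 1 / 2" and xy: "0 < x" "x \<le> 1/4" "0 < y" "y \<le> 1/4" and eq: "n0 = x * y * S x y"
  shows "x * y \<le> 4 * M\<^sup>2 * n0"
proof -
  have "1 \<le> 2 * M\<^sup>2 * Z 2" using Z_ge[OF n0, of 2] .
  also have "\<dots> \<le> 2 * M\<^sup>2 * (2 * S x y)" using Z_2_le_S[OF xy] by (intro mult_left_mono) auto
  finally have "x * y * 1 \<le> x * y * (2 * M\<^sup>2 * (2 * S x y))" using xy by (intro mult_left_mono) auto
  then show ?thesis using eq by (simp add: mult_ac)
qed

text \<open>The squared gap is \<open>((x - y)^2 + 4 x y) T^2\<close>. Its first part grows
  quadratically in \<open>x - y\<close>, while replacing \<open>x y\<close> by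
  \<open>n0 / Z 2\<close> and \<open>T\<close> by \<open>Z 1\<close> in the second costs only
  \<open>n0\<close> times a linear term. So an unbalanced pair loses against a balanced one.\<close>

lemma gap_sq_lower:
  assumes n0: "n0 \<le> 1 / 2" and xy: "0 < x" "x \<le> 1/4" "0 < y" "y \<le> 1/4" and eq: "n0 = x * y * S x y"
    and small: "32 * M\<^sup>2 * (x * y + \<bar>x - y\<bar>) \<le> 1"
  shows "(Z 1)\<^sup>2 * (x - y)\<^sup>2 / 2 + 4 * (Z 1)\<^sup>2 * n0 / Z 2 - 128 * M ^ 4 * n0 * (\<bar>x - y\<bar> + 4 * M\<^sup>2 * n0)
    \<le> ((x + y) * T x y)\<^sup>2"
proof -
  define h where "h = x * y + \<bar>x - y\<bar>"
  define v where "v = x * y"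
  have v0: "0 < v" using xy by (simp add: v_def)
  have h0: "0 < h" using v0 by (simp add: h_def v_def add_pos_nonneg)
  have v1: "v \<le> 4 * M\<^sup>2 * n0" using root_product_le[OF n0 xy eq] by (simp add: v_def)
  have Z2: "0 < Z 2" and Z2M: "1 / Z 2 \<le> 2 * M\<^sup>2"
    using Z_pos[of 2] Z_ge[OF n0, of 2] by (auto simp: field_simps)
  have T2: "(Z 1)\<^sup>2 - 4 * h \<le> (T x y)\<^sup>2"
  proof -
    have "(Z 1)\<^sup>2 + 2 * Z 1 * (T x y - Z 1) \<le> (T x y)\<^sup>2"
      using zero_le_power2[of "T x y - Z 1"] by (simp add: power2_eq_square algebra_simps)
    moreover have "Z 1 * - (T x y - Z 1) \<le> 1 * (2 * h)"
    proof -
      have "Z 1 * - (T x y - Z 1) \<le> Z 1 * (2 * h)"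
        using T_dev[OF xy] Z_pos[of 1] by (intro mult_left_mono) (auto simp: h_def)
      also have "\<dots> \<le> 1 * (2 * h)" using Z_le_1[of 1] h0 by (intro mult_right_mono) auto
      finally show ?thesis .
    qed
    moreover have "2 * Z 1 * (T x y - Z 1) = - 2 * (Z 1 * - (T x y - Z 1))" by (simp add: algebra_simps)
    ultimately show ?thesis by linarith
  qed
  \<comment> \<open>As \<open>Z 1 >= 1 / (2 M)\<close>, the hypothesis \<open>small\<close> yields
    \<open>8 h <= (Z 1)^2\<close>; the quadratic term keeps half of its coefficient.\<close>
  have half: "(Z 1)\<^sup>2 / 2 \<le> (Z 1)\<^sup>2 - 4 * h"
  proof -
    have "1 \<le> 2 * M * Z 1" using Z_ge[OF n0, of 1] by simp
    then have "1\<^sup>2 \<le> (2 * M * Z 1)\<^sup>2" by (intro power_mono) auto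
    then have "32 * M\<^sup>2 * h \<le> 4 * M\<^sup>2 * (Z 1)\<^sup>2" using small by (simp add: h_def power_mult_distrib)
    then have "4 * M\<^sup>2 * (8 * h) \<le> 4 * M\<^sup>2 * (Z 1)\<^sup>2" by simp
    then have "8 * h \<le> (Z 1)\<^sup>2" using M_ge by (subst (asm) mult_le_cancel_left_pos) auto
    then show ?thesis by simp
  qed
  \<comment> \<open>The difference \<open>n0 / Z 2 - n0 / S\<close> equals
    \<open>n0 (S - Z 2) / (S Z 2)\<close>.\<close>
  have vlow: "n0 / Z 2 - 16 * M ^ 4 * n0 * h \<le> v"
  proof -
    have S0: "0 < S x y" using Z2 Z_2_le_S[OF xy] by linarith
    have Sinv: "1 / S x y \<le> 4 * M\<^sup>2"
    proof -
      have "1 / S x y \<le> 2 / Z 2" using Z_2_le_S[OF xy] S0 Z2 by (simp add: field_simps)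
      then show ?thesis using Z2M by simp
    qed
    have veq: "v = n0 / S x y" using eq S0 by (simp add: v_def)
    have "n0 / Z 2 - v = n0 * (S x y - Z 2) * (1 / S x y * (1 / Z 2))"
      unfolding veq using S0 Z2 by (simp add: field_simps)
    also have "\<dots> \<le> n0 * (2 * h) * (1 / S x y * (1 / Z 2))"
      using S_dev[OF xy] n0_pos S0 Z2 by (intro mult_right_mono mult_left_mono) (auto simp: h_def)
    also have "\<dots> \<le> n0 * (2 * h) * (4 * M\<^sup>2 * (2 * M\<^sup>2))"
      using Sinv Z2M n0_pos h0 S0 Z2 by (intro mult_mono mult_left_mono) auto
    also have "\<dots> = 16 * M ^ 4 * n0 * h" by (simp add: eval_nat_numeral)
    finally show ?thesis by simp
  qed
  have Z1sq: "(Z 1)\<^sup>2 \<le> 1" using Z_le_1[of 1] Z_pos[of 1] by (simp add: power_le_one)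
  have M4: "M\<^sup>2 \<le> M ^ 4" using M_ge by (intro power_increasing) auto
  have "(x - y)\<^sup>2 * ((Z 1)\<^sup>2 / 2) \<le> (x - y)\<^sup>2 * ((Z 1)\<^sup>2 - 4 * h)"
    using half by (intro mult_left_mono) auto
  moreover have "4 * (Z 1)\<^sup>2 * (n0 / Z 2) - 64 * M ^ 4 * n0 * h \<le> 4 * v * (Z 1)\<^sup>2"
  proof -
    have "(Z 1)\<^sup>2 * (n0 / Z 2 - 16 * M ^ 4 * n0 * h) \<le> (Z 1)\<^sup>2 * v" using vlow by (intro mult_left_mono) auto
    moreover have "(Z 1)\<^sup>2 * (16 * M ^ 4 * n0 * h) \<le> 1 * (16 * M ^ 4 * n0 * h)"
      using Z1sq n0_pos h0 M_ge by (intro mult_right_mono) auto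
    moreover have "4 * P * a - 4 * b \<le> 4 * u * P" if "P * (a - b) \<le> P * u" "P * b \<le> 1 * b" for P a b u :: real
      using that by (simp add: algebra_simps)
    ultimately have "4 * (Z 1)\<^sup>2 * (n0 / Z 2) - 4 * (16 * M ^ 4 * n0 * h) \<le> 4 * v * (Z 1)\<^sup>2" by blast
    then show ?thesis by simp
  qed
  moreover have "16 * v * h \<le> 64 * M ^ 4 * n0 * h"
  proof -
    have "16 * v \<le> 64 * (M\<^sup>2 * n0)" using v1 by linarith
    also have "\<dots> \<le> 64 * (M ^ 4 * n0)" using M4 n0_pos by simp
    finally show ?thesis using h0 by (intro mult_right_mono) auto
  qed
  moreover have "((x - y)\<^sup>2 + 4 * v) * ((Z 1)\<^sup>2 - 4 * h) \<le> ((x - y)\<^sup>2 + 4 * v) * (T x y)\<^sup>2"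
    using T2 v0 by (intro mult_left_mono) auto
  moreover have "((x - y)\<^sup>2 + 4 * v) * (T x y)\<^sup>2 = ((x + y) * T x y)\<^sup>2"
    by (simp add: v_def power2_eq_square algebra_simps)
  \<comment> \<open>The factor 128 collects 64 from the error in \<open>v\<close> and 64 from
    \<open>16 v h\<close>.\<close>
  moreover have "128 * M ^ 4 * n0 * h \<le> 128 * M ^ 4 * n0 * (\<bar>x - y\<bar> + 4 * M\<^sup>2 * n0)"
  proof (intro mult_left_mono)
    show "h \<le> \<bar>x - y\<bar> + 4 * M\<^sup>2 * n0" using v1 unfolding h_def v_def by linarith
  qed (use n0_pos M_ge in auto)
  ultimately show ?thesis by (simp add: algebra_simps)
qed

text \<open>The competitor for the minimum. On the diagonal \<open>(e + r) (e - r) <= e^2\<close>,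
  so \<open>S >= Z 2\<close> and \<open>r^2 <= n0 / Z 2\<close> without error term, while
  \<open>T\<close> exceeds \<open>Z 1\<close> by at most \<open>4 M^2 n0\<close>.\<close>

lemma balanced_pair:
  assumes n0: "32 * M\<^sup>2 * n0 \<le> 1"
  obtains r where "0 < r" "r \<le> 1/4" "n0 = r * r * S r r" "r\<^sup>2 \<le> 2 * M\<^sup>2 * n0"
    "((r + r) * T r r)\<^sup>2 \<le> 4 * (Z 1)\<^sup>2 * n0 / Z 2 + 192 * M ^ 6 * n0\<^sup>2"
proof -
  have M2: "1 \<le> M\<^sup>2" using M_ge by simp
  have n0': "n0 \<le> 1 / 2"
  proof -
    have "1 * n0 \<le> M\<^sup>2 * n0" using M2 n0_pos by (intro mult_right_mono) auto
    then show ?thesis using n0 by linarith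
  qed
  let ?f = "\<lambda>r. r * r * S r r"
  \<comment> \<open>The function is at least \<open>Z 2 / 16\<close> here, which the hypothesis
    makes at least \<open>n0\<close>.\<close>
  have up: "n0 \<le> ?f (1/4)"
  proof -
    have "32 * M\<^sup>2 * n0 \<le> 2 * M\<^sup>2 * Z 2" using n0 Z_ge[OF n0', of 2] by linarith
    then have "2 * M\<^sup>2 * (16 * n0) \<le> 2 * M\<^sup>2 * Z 2" by simp
    then have "16 * n0 \<le> Z 2" using M2 by (subst (asm) mult_le_cancel_left_pos) auto
    also have "Z 2 \<le> S (1/4) (1/4)"
      unfolding Z_def S_def
    proof (rule sum_mono)
      fix e assume e: "e \<in> L"
      have "(real e + 1/4) * (real e - 1/4) \<le> real e ^ 2" by (simp add: algebra_simps power2_eq_square)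
      then show "w e / (real e)\<^sup>2 \<le> w e / ((real e + 1/4) * (real e - 1/4))"
        using w_nonneg[OF e] denom_bounds(3)[OF e, of "1/4" "1/4"] L_pos[OF e]
        by (intro divide_left_mono) auto
    qed
    finally show ?thesis by simp
  qed
  have "\<exists>r\<ge>0. r \<le> 1/4 \<and> ?f r = n0"
  proof (rule IVT[where f="?f" and a=0 and b="1/4", OF _ up])
    show "\<forall>x. 0 \<le> x \<and> x \<le> 1/4 \<longrightarrow> isCont ?f x"
      unfolding S_def
    proof (intro allI impI continuous_intros)
      fix x :: real and e assume "0 \<le> x \<and> x \<le> 1/4" "e \<in> L"
      with L_ge[of e] show "(real e + x) * (real e - x) \<noteq> 0" by auto
    qed
  qed (use n0_pos in auto)
  then obtain r where r: "0 \<le> r" "r \<le> 1/4" "?f r = n0" by blast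
  have r0: "0 < r" using r n0_pos by (cases "r = 0") auto
  have Z2: "0 < Z 2" and Z2M: "1 / Z 2 \<le> 2 * M\<^sup>2"
    using Z_pos[of 2] Z_ge[OF n0', of 2] by (auto simp: field_simps)
  have ZS: "Z 2 \<le> S r r"
    unfolding Z_def S_def
  proof (rule sum_mono)
    fix e assume e: "e \<in> L"
    have "(real e + r) * (real e - r) \<le> real e ^ 2" by (simp add: algebra_simps power2_eq_square)
    then show "w e / (real e)\<^sup>2 \<le> w e / ((real e + r) * (real e - r))"
      using w_nonneg[OF e] denom_bounds(3)[OF e r0 r(2) r0 r(2)] L_pos[OF e]
      by (intro divide_left_mono) auto
  qed
  have "r\<^sup>2 * Z 2 \<le> r\<^sup>2 * S r r" using ZS by (intro mult_left_mono) auto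
  then have v: "r\<^sup>2 \<le> n0 / Z 2" using r(3) Z2 by (simp add: power2_eq_square pos_le_divide_eq)
  have nZ: "n0 / Z 2 \<le> 2 * M\<^sup>2 * n0" using Z2M n0_pos mult_left_mono[of "1 / Z 2" "2 * M\<^sup>2" n0] by (simp add: mult_ac)
  have v': "r\<^sup>2 \<le> 2 * M\<^sup>2 * n0" using v nZ by simp
  define k where "k = 4 * M\<^sup>2 * n0"
  have k: "0 \<le> k" "k \<le> 1" using n0_pos n0 by (auto simp: k_def)
  have T: "T r r \<le> Z 1 + k"
    using T_dev[OF r0 r(2) r0 r(2)] v' by (simp add: power2_eq_square k_def)
  have T0: "0 \<le> T r r" using T_ge[OF r0 r(2) r0 r(2)] Z_pos[of 1] by linarith
  have "((r + r) * T r r)\<^sup>2 = 4 * r\<^sup>2 * (T r r)\<^sup>2" by (simp add: power2_eq_square)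
  also have "\<dots> \<le> 4 * (n0 / Z 2) * (Z 1 + k)\<^sup>2"
    using v T T0 n0_pos Z2 by (intro mult_mono power_mono) auto
  also have "(Z 1 + k)\<^sup>2 \<le> (Z 1)\<^sup>2 + 3 * k"
  proof -
    have "Z 1 * k \<le> 1 * k" "k * k \<le> 1 * k" using Z_le_1[of 1] k by (intro mult_right_mono; simp)+
    then show ?thesis by (simp add: power2_eq_square algebra_simps)
  qed
  then have "4 * (n0 / Z 2) * (Z 1 + k)\<^sup>2 \<le> 4 * (n0 / Z 2) * ((Z 1)\<^sup>2 + 3 * k)"
    using n0_pos Z2 by (intro mult_left_mono) auto
  also have "\<dots> = 4 * (Z 1)\<^sup>2 * n0 / Z 2 + 12 * k * (n0 / Z 2)" by (simp add: algebra_simps)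
  also have "12 * k * (n0 / Z 2) \<le> 12 * k * (2 * M\<^sup>2 * n0)" using nZ k by (intro mult_left_mono) auto
  also have "12 * k * (2 * M\<^sup>2 * n0) = 96 * M ^ 4 * n0\<^sup>2" by (simp add: k_def eval_nat_numeral)
  also have "\<dots> \<le> 192 * M ^ 6 * n0\<^sup>2"
  proof -
    have "M ^ 4 \<le> M ^ 6" using M_ge by (intro power_increasing) auto
    moreover have "0 < M ^ 6" using M_ge by simp
    ultimately have "96 * M ^ 4 \<le> 192 * M ^ 6" by linarith
    then show ?thesis by (intro mult_right_mono) auto
  qed
  finally have "((r + r) * T r r)\<^sup>2 \<le> 4 * (Z 1)\<^sup>2 * n0 / Z 2 + 192 * M ^ 6 * n0\<^sup>2" by simp
  with that[of r] r0 r v' show thesis by auto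
qed

text \<open>The gap equals \<open>x F(-x) + y F(y)\<close> with both summands bounded below, so a
  small gap forces small roots. This brings every competitive pair into the range of the local
  estimates.\<close>

lemma roots_le_gap:
  assumes n0: "n0 \<le> 1 / 2" and xy: "0 < x" "0 < y" "y < lowest" and g: "(x + y) * T x y \<le> g" "g \<le> 1/4"
  shows "x \<le> 4 * M * g" "y \<le> 4 * M * g"
proof -
  have M: "1 \<le> M" by (rule M_ge)
  have wsum: "1 / 2 \<le> (\<Sum>e\<in>L. w e)" using total n0 by linarith
  have 1: "x / (2 * (M + x)) \<le> x * F (- x)"
  proof -
    have "1 / 2 * (x / (M + x)) \<le> (\<Sum>e\<in>L. w e) * (x / (M + x))"
      using wsum xy M by (intro mult_right_mono) auto
    also have "\<dots> \<le> x * F (- x)"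
      unfolding F_def sum_distrib_left sum_distrib_right
    proof (rule sum_mono)
      fix e assume e: "e \<in> L"
      have "w e * x / (M + x) \<le> w e * x / (real e + x)"
        using L_le[OF e] L_pos[OF e] w_nonneg[OF e] xy by (intro divide_left_mono mult_nonneg_nonneg mult_pos_pos) auto
      then show "w e * (x / (M + x)) \<le> x * (w e / (real e - - x))" by (simp add: mult_ac)
    qed
    finally show ?thesis by simp
  qed
  have 2: "y / (2 * M) \<le> y * F y"
  proof -
    have "1 / 2 * (y / M) \<le> (\<Sum>e\<in>L. w e) * (y / M)"
      using wsum xy M by (intro mult_right_mono) auto
    also have "\<dots> \<le> y * F y"
      unfolding F_def sum_distrib_left sum_distrib_right
    proof (rule sum_mono)
      fix e assume e: "e \<in> L"
      have "0 < real e - y" using lowest_le[OF e] xy by linarith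
      then have "w e * y / M \<le> w e * y / (real e - y)"
        using L_le[OF e] w_nonneg[OF e] xy M by (intro divide_left_mono mult_nonneg_nonneg mult_pos_pos) auto
      then show "w e * (y / M) \<le> y * (w e / (real e - y))" by (simp add: mult_ac)
    qed
    finally show ?thesis by simp
  qed
  have sum: "x * F (- x) + y * F y \<le> g" using F_comb[OF xy] g by simp
  have "0 \<le> x / (2 * (M + x))" "0 \<le> y / (2 * M)" using xy M by auto
  then have x: "x / (2 * (M + x)) \<le> g" and y: "y / (2 * M) \<le> g" and g0: "0 \<le> g" using 1 2 sum by linarith+
  have "y \<le> 2 * M * g" using y M by (simp add: pos_divide_le_eq mult_ac)
  also have "\<dots> \<le> 4 * M * g" using M g0 by (intro mult_right_mono) auto
  finally show "y \<le> 4 * M * g" .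
  \<comment> \<open>The term \<open>2 g x\<close> is absorbed on the left because
    \<open>g <= 1/4\<close>.\<close>
  have "x \<le> 2 * M * g + 2 * g * x" using x M xy by (simp add: pos_divide_le_eq algebra_simps)
  also have "2 * g * x \<le> 1 / 2 * x" using g xy by (intro mult_right_mono) auto
  finally show "x \<le> 4 * M * g" by simp
qed

section \<open>The gap as a function of the annealing parameter and its minimizers\<close>

definition root_gap :: "real \<Rightarrow> real" where "root_gap z = z * (neg_root z + pos_root z)"

lemma roots_T:
  assumes "0 < x" "0 < y" "y < lowest" "n0 = x * y * S x y"
  shows "0 < T x y" "neg_root (T x y) = x" "pos_root (T x y) = y"
proof -
  note eqs = root_pairI[OF assms]
  show T: "0 < T x y" using root_neg_gt_0[OF assms(1)] eqs by simp
  show "neg_root (T x y) = x" using neg_root_unique[OF assms(1)] eqs by simp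
  show "pos_root (T x y) = y" using pos_root_unique[OF assms(2,3)] eqs T by simp
qed

lemma roots_pair:
  assumes "0 < z"
  shows "n0 = neg_root z * pos_root z * S (neg_root z) (pos_root z)" "T (neg_root z) (pos_root z) = z"
  using root_pair[OF neg_root(1) pos_root(1,2) neg_root(2) pos_root(3)] assms by auto

lemma root_gap_eq: "0 < z \<Longrightarrow> root_gap z = (neg_root z + pos_root z) * T (neg_root z) (pos_root z)"
  using roots_pair by (simp add: root_gap_def mult.commute)

text \<open>Derives the various smallness conditions from a single one; \<open>k = 0\<close> gives
  \<open>n0 <= 1/2\<close>.\<close>

lemma power_M_n0_le:
  assumes "3000000 * M ^ 11 * n0 \<le> 1" "k \<le> 11"
  shows "3000000 * (M ^ k * n0) \<le> 1"
proof -
  have "M ^ k * n0 \<le> M ^ 11 * n0"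
    using M_ge assms n0_pos by (intro mult_right_mono power_increasing) auto
  then show ?thesis using assms by linarith
qed

text \<open>The parameter belonging to the balanced pair. Its gap is small enough for
  \<open>small_gap_roots\<close>, and it lies in the compact window used for the existence of a
  minimizer.\<close>

lemma balanced_point:
  assumes small: "3000000 * M ^ 11 * n0 \<le> 1"
  obtains z0 where "1 / (4 * M) \<le> z0" "z0 \<le> 2" "0 \<le> root_gap z0" "root_gap z0 \<le> 1 / 4"
    "64 * M\<^sup>2 * (4 * M * root_gap z0) \<le> 1"
    "(root_gap z0)\<^sup>2 \<le> 4 * (Z 1)\<^sup>2 * n0 / Z 2 + 192 * M ^ 6 * n0\<^sup>2"
proof -
  have n2: "32 * M\<^sup>2 * n0 \<le> 1" using power_M_n0_le[OF small, of 2] n0_pos M_ge by simp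
  have n0': "n0 \<le> 1 / 2" using power_M_n0_le[OF small, of 0] by simp
  obtain r where r: "0 < r" "r \<le> 1/4" "n0 = r * r * S r r" "r\<^sup>2 \<le> 2 * M\<^sup>2 * n0"
    "((r + r) * T r r)\<^sup>2 \<le> 4 * (Z 1)\<^sup>2 * n0 / Z 2 + 192 * M ^ 6 * n0\<^sup>2"
    using balanced_pair[OF n2] .
  have rc: "r < lowest" using r lowest_ge by simp
  note rT = roots_T[OF r(1,1) rc r(3)]
  have g: "root_gap (T r r) = (r + r) * T r r" using root_gap_eq[OF rT(1)] rT by simp
  have T2: "T r r \<le> 2" using T_le[OF r(1,2,1,2)] Z_le_1[of 1] by linarith
  have T1: "1 / (4 * M) \<le> T r r"
  proof -
    have "1 / M \<le> 2 * Z 1" using Z_ge[OF n0', of 1] M_ge by (simp add: field_simps)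
    then show ?thesis using T_ge[OF r(1,2,1,2)] by simp
  qed
  define g0 where "g0 = root_gap (T r r)"
  have g0: "0 \<le> g0" using g rT(1) r by (simp add: g0_def)
  have "(T r r)\<^sup>2 \<le> 2\<^sup>2" using T2 rT(1) by (intro power_mono) auto
  then have "4 * r\<^sup>2 * (T r r)\<^sup>2 \<le> 4 * (2 * M\<^sup>2 * n0) * 2\<^sup>2"
    using r(4) n0_pos by (intro mult_mono) auto
  then have gsq: "g0\<^sup>2 \<le> 32 * (M\<^sup>2 * n0)" by (simp add: g0_def g power2_eq_square)
  have "g0\<^sup>2 \<le> (1/4)\<^sup>2" using gsq power_M_n0_le[OF small, of 2] by (simp add: power2_eq_square)
  then have g4: "g0 \<le> 1/4" by (rule power2_le_imp_le) simp
  \<comment> \<open>The gap is at most of order \<open>M sqrt n0\<close>, so this square is of order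
    \<open>M^8 n0\<close>. Its coefficient 2097152 dictates the size of the constant
    3000000.\<close>
  have "(64 * M\<^sup>2 * (4 * M * g0))\<^sup>2 = 65536 * M ^ 6 * g0\<^sup>2" by (simp add: eval_nat_numeral)
  also have "\<dots> \<le> 65536 * M ^ 6 * (32 * (M\<^sup>2 * n0))" using gsq M_ge by (intro mult_left_mono) auto
  also have "\<dots> = 2097152 * (M ^ 8 * n0)" by (simp add: eval_nat_numeral)
  also have "\<dots> \<le> 1\<^sup>2" using power_M_n0_le[OF small, of 8] n0_pos M_ge by simp
  finally have "64 * M\<^sup>2 * (4 * M * g0) \<le> 1" by (rule power2_le_imp_le) simp
  with that[of "T r r"] T1 T2 g0 g4 r(5) g show thesis by (simp add: g0_def)
qed

lemma small_gap_roots: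
  assumes n0: "n0 \<le> 1 / 2" and z: "0 < z" and g: "root_gap z \<le> g" "g \<le> 1 / 4" "64 * M\<^sup>2 * (4 * M * g) \<le> 1"
  shows "neg_root z \<le> 1/4" "pos_root z \<le> 1/4" "32 * M\<^sup>2 * (neg_root z * pos_root z + \<bar>neg_root z - pos_root z\<bar>) \<le> 1"
proof -
  define b where "b = 4 * M * g"
  have xb: "neg_root z \<le> b" "pos_root z \<le> b"
    using roots_le_gap[OF n0 neg_root(1)[OF z] pos_root(1,2)[OF z]] root_gap_eq[OF z] g by (auto simp: b_def)
  have x0: "0 < neg_root z" "0 < pos_root z" using neg_root pos_root z by auto
  have b: "64 * M\<^sup>2 * b \<le> 1" using g by (simp add: b_def)
  have "64 * 1 * b \<le> 64 * M\<^sup>2 * b" using M_ge xb x0 by (intro mult_right_mono mult_left_mono) auto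
  then have b64: "b \<le> 1 / 64" using b by linarith
  then show "neg_root z \<le> 1/4" "pos_root z \<le> 1/4" using xb by auto
  have "neg_root z * pos_root z \<le> 1 * b" using xb x0 b64 by (intro mult_mono) auto
  moreover have "\<bar>neg_root z - pos_root z\<bar> \<le> b" using xb x0 by linarith
  ultimately have "32 * M\<^sup>2 * (neg_root z * pos_root z + \<bar>neg_root z - pos_root z\<bar>) \<le> 32 * M\<^sup>2 * (2 * b)"
    by (intro mult_left_mono) auto
  then show "32 * M\<^sup>2 * (neg_root z * pos_root z + \<bar>neg_root z - pos_root z\<bar>) \<le> 1" using b by linarith
qed

text \<open>Continuity gives a minimum over the window from \<open>1 / (4 M)\<close> to 2. A
  parameter whose gap does not exceed that of \<open>z0\<close> has small roots, so
  \<open>z = T\<close> lies between \<open>Z 1 / 2\<close> and \<open>2 Z 1\<close>, inside the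
  window; any other parameter is beaten by \<open>z0\<close>.\<close>

lemma ex_min_gap:
  assumes small: "3000000 * M ^ 11 * n0 \<le> 1"
  shows "\<exists>zs>0. \<forall>z>0. root_gap zs \<le> root_gap z"
proof -
  have n0': "n0 \<le> 1 / 2" using power_M_n0_le[OF small, of 0] by simp
  obtain z0 where z0: "1 / (4 * M) \<le> z0" "z0 \<le> 2" "root_gap z0 \<le> 1 / 4" "64 * M\<^sup>2 * (4 * M * root_gap z0) \<le> 1"
    using balanced_point[OF small] .
  have M0: "0 < 1 / (4 * M)" using M_ge by simp
  have "\<exists>m. (\<forall>z. 1 / (4 * M) \<le> z \<and> z \<le> 2 \<longrightarrow> m \<le> root_gap z) \<and> (\<exists>z\<ge>1 / (4 * M). z \<le> 2 \<and> root_gap z = m)"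
  proof (rule isCont_eq_Lb)
    show "\<forall>z. 1 / (4 * M) \<le> z \<and> z \<le> 2 \<longrightarrow> isCont root_gap z"
    proof (intro allI impI)
      fix z assume "1 / (4 * M) \<le> z \<and> z \<le> 2"
      then have "0 < z" using M0 by linarith
      then show "isCont root_gap z"
        unfolding root_gap_def by (intro continuous_intros isCont_neg_root isCont_pos_root)
    qed
  qed (use z0 in linarith)
  then obtain zs where zs: "1 / (4 * M) \<le> zs" "zs \<le> 2"
    "\<And>z. 1 / (4 * M) \<le> z \<Longrightarrow> z \<le> 2 \<Longrightarrow> root_gap zs \<le> root_gap z" by blast
  have "root_gap zs \<le> root_gap z" if z: "0 < z" for z
  proof (cases "root_gap z \<le> root_gap z0")
    case True
    note xy = small_gap_roots[OF n0' z True z0(3,4)]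
    have "Z 1 \<le> 2 * z" "z \<le> 2 * Z 1"
      using T_ge[OF neg_root(1)[OF z] xy(1) pos_root(1)[OF z] xy(2)] T_le[OF neg_root(1)[OF z] xy(1) pos_root(1)[OF z] xy(2)]
        roots_pair(2)[OF z] by auto
    moreover have "1 / M \<le> 2 * Z 1" using Z_ge[OF n0', of 1] M_ge by (simp add: field_simps)
    ultimately show ?thesis using zs(3)[of z] Z_le_1[of 1] by simp
  next
    case False
    then show ?thesis using zs(3)[OF z0(1,2)] by linarith
  qed
  moreover have "0 < zs" using zs(1) M0 by linarith
  ultimately show ?thesis by blast
qed

text \<open>The lower estimate at the minimizer meets the upper estimate at the balanced point. Both
  share the leading term \<open>B2\<close>, and what remains is a quadratic inequality that forces
  \<open>u = O(n0)\<close>.\<close>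

lemma min_gap_estimates:
  assumes small: "3000000 * M ^ 11 * n0 \<le> 1" and z: "0 < z" and min: "\<And>t. 0 < t \<Longrightarrow> root_gap z \<le> root_gap t"
  shows "\<bar>z - Z 1\<bar> \<le> 3000000 * M ^ 11 * n0"
    "\<bar>root_gap z - 2 * Z 1 * sqrt (n0 / Z 2)\<bar> \<le> 3000000 * M ^ 11 * n0 powr (3 / 2)"
proof -
  have n0': "n0 \<le> 1 / 2" using power_M_n0_le[OF small, of 0] by simp
  have M: "1 \<le> M" by (rule M_ge)
  obtain z0 where z0: "1 / (4 * M) \<le> z0" "root_gap z0 \<le> 1 / 4" "64 * M\<^sup>2 * (4 * M * root_gap z0) \<le> 1"
    "(root_gap z0)\<^sup>2 \<le> 4 * (Z 1)\<^sup>2 * n0 / Z 2 + 192 * M ^ 6 * n0\<^sup>2"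
    using balanced_point[OF small] .
  have z00: "0 < z0" using M order_less_le_trans[OF _ z0(1), of 0] by simp
  define x where "x = neg_root z"
  define y where "y = pos_root z"
  define u where "u = \<bar>x - y\<bar>"
  define t where "t = M ^ 6 * n0"
  define B2 where "B2 = 4 * (Z 1)\<^sup>2 * n0 / Z 2"
  have t0: "0 < t" using M n0_pos by (simp add: t_def)
  have u0: "0 \<le> u" by (simp add: u_def)
  have xy0: "0 < x" "0 < y" using neg_root pos_root z by (auto simp: x_def y_def)
  have gpos: "0 < root_gap z" using z xy0 by (simp add: root_gap_def x_def y_def)
  note xy = small_gap_roots[OF n0' z min[OF z00] z0(2,3), folded x_def y_def]
  have eq: "n0 = x * y * S x y" and Tz: "T x y = z" using roots_pair[OF z] by (auto simp: x_def y_def)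
  have low: "(Z 1)\<^sup>2 * u\<^sup>2 / 2 + B2 - 128 * M ^ 4 * n0 * (u + 4 * M\<^sup>2 * n0) \<le> (root_gap z)\<^sup>2"
    using gap_sq_lower[OF n0' xy0(1) xy(1) xy0(2) xy(2) eq xy(3)] root_gap_eq[OF z]
    by (simp add: u_def B2_def x_def y_def)
  have up: "(root_gap z)\<^sup>2 \<le> B2 + 192 * M ^ 6 * n0\<^sup>2"
  proof -
    have "(root_gap z)\<^sup>2 \<le> (root_gap z0)\<^sup>2" using min[OF z00] gpos by (intro power_mono) auto
    then show ?thesis using z0(4) by (simp add: B2_def)
  qed
  have v: "x * y \<le> 4 * t"
  proof -
    have "M\<^sup>2 * n0 \<le> M ^ 6 * n0" using M n0_pos by (intro mult_right_mono power_increasing) auto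
    then show ?thesis using root_product_le[OF n0' xy0(1) xy(1) xy0(2) xy(2) eq] by (simp add: t_def)
  qed
  \<comment> \<open>Multiplying by \<open>8 M^2\<close> isolates \<open>u^2\<close>, since
    \<open>4 M^2 (Z 1)^2 >= 1\<close>; 5632 is \<open>8 (512 + 192)\<close>.\<close>
  have "u\<^sup>2 \<le> 1024 * t * u + 5632 * t\<^sup>2"
  proof -
    have "1\<^sup>2 \<le> (2 * M * Z 1)\<^sup>2" using Z_ge[OF n0', of 1] by (intro power_mono) auto
    then have "1 * u\<^sup>2 \<le> 4 * M\<^sup>2 * (Z 1)\<^sup>2 * u\<^sup>2" by (intro mult_right_mono) (auto simp: power_mult_distrib)
    also have "\<dots> = 8 * M\<^sup>2 * ((Z 1)\<^sup>2 * u\<^sup>2 / 2)" by simp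
    also have "\<dots> \<le> 8 * M\<^sup>2 * (128 * M ^ 4 * n0 * (u + 4 * M\<^sup>2 * n0) + 192 * M ^ 6 * n0\<^sup>2)"
      using low up by (intro mult_left_mono) auto
    also have "\<dots> = 1024 * t * u + 5632 * (M ^ 8 * n0\<^sup>2)"
      by (simp add: t_def algebra_simps eval_nat_numeral)
    also have "M ^ 8 * n0\<^sup>2 \<le> M ^ 12 * n0\<^sup>2" using M by (intro mult_right_mono power_increasing) auto
    also have "M ^ 12 * n0\<^sup>2 = t\<^sup>2" by (simp add: t_def power_mult_distrib flip: power_mult)
    finally show ?thesis by simp
  qed
  \<comment> \<open>For \<open>u > 1100 t\<close> one has \<open>1100 t u <= u^2\<close>, and the
    quadratic inequality leaves \<open>76 u <= 5632 t\<close>, a contradiction.\<close>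
  have ut: "u \<le> 1100 * t"
  proof (rule ccontr)
    assume n: "\<not> u \<le> 1100 * t"
    have "1100 * t * u \<le> u * u" using n u0 by (intro mult_right_mono) auto
    then have "76 * t * u \<le> 5632 * t\<^sup>2" using \<open>u\<^sup>2 \<le> _\<close> by (simp add: power2_eq_square)
    then have "t * (76 * u) \<le> t * (5632 * t)" by (simp add: power2_eq_square)
    then have "76 * u \<le> 5632 * t" using t0 by simp
    then show False using n t0 by linarith
  qed
  have M6: "M ^ 6 * n0 \<le> M ^ 11 * n0" using M n0_pos by (intro mult_right_mono power_increasing) auto
  have "\<bar>z - Z 1\<bar> \<le> 2 * (x * y + u)"
    using T_dev[OF xy0(1) xy(1) xy0(2) xy(2)] by (simp add: Tz u_def)
  also have "\<dots> \<le> 2208 * t" using v ut by (simp add: algebra_simps)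
  also have "\<dots> \<le> 3000000 * M ^ 11 * n0" using M6 t0 unfolding t_def by linarith
  finally show "\<bar>z - Z 1\<bar> \<le> 3000000 * M ^ 11 * n0" .
  define B where "B = 2 * Z 1 * sqrt (n0 / Z 2)"
  define q where "q = sqrt n0"
  have q: "0 < q" "q\<^sup>2 = n0" using n0_pos by (auto simp: q_def)
  have Z2: "0 < Z 2" by (rule Z_pos)
  have B2: "B\<^sup>2 = B2" using n0_pos Z2 by (simp add: B_def B2_def power_mult_distrib)
  \<comment> \<open>The leading term is at least of order \<open>sqrt n0 / M\<close>; it will divide
    the difference of squares.\<close>
  have Bq: "q / M \<le> B"
  proof -
    have "n0 / 1 \<le> n0 / Z 2" using Z_le_1[of 2] Z2 n0_pos by (intro divide_left_mono) auto
    then have "q \<le> sqrt (n0 / Z 2)" by (simp add: q_def)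
    moreover have "1 / M \<le> 2 * Z 1" using Z_ge[OF n0', of 1] M by (simp add: field_simps)
    ultimately have "1 / M * q \<le> 2 * Z 1 * sqrt (n0 / Z 2)"
      using Z_pos[of 1] q M by (intro mult_mono) auto
    then show ?thesis by (simp add: B_def)
  qed
  define C where "C = 141312 * M ^ 10 * n0\<^sup>2"
  have "128 * M ^ 4 * n0 * (u + 4 * M\<^sup>2 * n0) \<le> 128 * M ^ 4 * n0 * (1104 * t)"
  proof -
    have "M\<^sup>2 * n0 \<le> M ^ 6 * n0" using M n0_pos by (intro mult_right_mono power_increasing) auto
    then have "u + 4 * M\<^sup>2 * n0 \<le> 1104 * t" using ut unfolding t_def by linarith
    then show ?thesis using M n0_pos by (intro mult_left_mono) auto
  qed
  also have "\<dots> = C" by (simp add: C_def t_def eval_nat_numeral)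
  finally have C1: "128 * M ^ 4 * n0 * (u + 4 * M\<^sup>2 * n0) \<le> C" .
  have C2: "192 * M ^ 6 * n0\<^sup>2 \<le> C"
  proof -
    have "M ^ 6 * n0\<^sup>2 \<le> M ^ 10 * n0\<^sup>2" using M by (intro mult_right_mono power_increasing) auto
    moreover have "0 \<le> M ^ 10 * n0\<^sup>2" using M by simp
    ultimately show ?thesis unfolding C_def by linarith
  qed
  have "0 \<le> (Z 1)\<^sup>2 * u\<^sup>2 / 2" by simp
  then have "\<bar>(root_gap z)\<^sup>2 - B\<^sup>2\<bar> \<le> C" using low up C1 C2 B2 by linarith
  \<comment> \<open>An error \<open>O(n0^2)\<close> in the squared gap becomes
    \<open>O(n0 powr (3/2))\<close> in the gap after division by a quantity of order
    \<open>sqrt n0\<close>.\<close>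
  moreover have "\<bar>(root_gap z)\<^sup>2 - B\<^sup>2\<bar> = \<bar>root_gap z - B\<bar> * (root_gap z + B)"
  proof -
    have "0 < q / M" using q M by simp
    then have "0 < root_gap z + B" using gpos Bq by linarith
    moreover have "(root_gap z)\<^sup>2 - B\<^sup>2 = (root_gap z - B) * (root_gap z + B)" by (simp add: power2_eq_square algebra_simps)
    ultimately show ?thesis by (simp add: abs_mult)
  qed
  moreover have "\<bar>root_gap z - B\<bar> * (q / M) \<le> \<bar>root_gap z - B\<bar> * (root_gap z + B)"
    using Bq gpos by (intro mult_left_mono) auto
  ultimately have "\<bar>root_gap z - B\<bar> * (q / M) \<le> C" by linarith
  then have "\<bar>root_gap z - B\<bar> * q \<le> C * M" using M by (simp add: field_simps)
  also have "C * M = 141312 * M ^ 11 * (n0 * q) * q"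
    unfolding C_def using q by (simp add: eval_nat_numeral mult_ac)
  finally have "\<bar>root_gap z - B\<bar> \<le> 141312 * M ^ 11 * (n0 * q)" using q by simp
  also have "\<dots> \<le> 3000000 * M ^ 11 * (n0 * q)" using M n0_pos q by (intro mult_right_mono) auto
  also have "n0 * q = n0 powr (3 / 2)"
    using n0_pos powr_add[of n0 1 "1/2"] by (simp add: q_def powr_half_sqrt)
  finally show "\<bar>root_gap z - 2 * Z 1 * sqrt (n0 / Z 2)\<bar> \<le> 3000000 * M ^ 11 * n0 powr (3 / 2)"
    by (simp add: B_def)
qed

end

section \<open>Spectrum of the Hamiltonian\<close>

lemma hamiltonian_carrier [simp]: "hamiltonian n E z \<in> carrier_mat (2 ^ n) (2 ^ n)"
  unfolding hamiltonian_def ket_bra_def uniform_state_def mat_diag_def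
  by (intro carrier_matI) auto

lemma inner_uniform_state:
  assumes "v \<in> carrier_vec (2 ^ n)"
  shows "v \<bullet>c uniform_state n = (\<Sum>s<2 ^ n. v $ s) / complex_of_real (sqrt (2 ^ n))"
  using assms unfolding scalar_prod_def uniform_state_def
  by (simp add: sum_divide_distrib lessThan_atLeast0)

lemma hamiltonian_mult_vec:
  assumes v: "v \<in> carrier_vec (2 ^ n)" and s: "s < 2 ^ n"
  shows "(hamiltonian n E z *\<^sub>v v) $ s =
    of_real (z * E s) * v $ s - (v \<bullet>c uniform_state n) / complex_of_real (sqrt (2 ^ n))"
proof -
  let ?r = "complex_of_real (sqrt (2 ^ n))"
  have "(hamiltonian n E z *\<^sub>v v) $ s = (\<Sum>t<2 ^ n. hamiltonian n E z $$ (s, t) * v $ t)"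
    using v s carrier_matD[OF hamiltonian_carrier[of n E z]]
    by (auto simp: scalar_prod_def lessThan_atLeast0 intro!: sum.cong)
  also have "\<dots> = (\<Sum>t<2 ^ n. - (v $ t / ?r / ?r) + (if t = s then of_real (z * E s) * v $ t else 0))"
    using s by (intro sum.cong) (auto simp: hamiltonian_def ket_bra_def uniform_state_def mat_diag_def algebra_simps)
  also have "\<dots> = - ((\<Sum>t<2 ^ n. v $ t) / ?r / ?r) + of_real (z * E s) * v $ s"
    using s by (simp only: sum.distrib sum_negf sum_divide_distrib sum.delta finite_lessThan lessThan_iff if_True)
  finally show ?thesis using inner_uniform_state[OF v] by simp
qed

text \<open>The projector has rank one, so it enters every component through the same constant, the
  overlap divided by \<open>sqrt N\<close>.\<close>

lemma eigenvector_hamiltonian_iff: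
  "eigenvector (hamiltonian n E z) v (of_real l) \<longleftrightarrow>
    v \<in> carrier_vec (2 ^ n) \<and> v \<noteq> 0\<^sub>v (2 ^ n) \<and>
    (\<forall>s<2 ^ n. of_real (z * E s - l) * v $ s = (v \<bullet>c uniform_state n) / complex_of_real (sqrt (2 ^ n)))"
proof -
  have d: "dim_row (hamiltonian n E z) = 2 ^ n" "dim_col (hamiltonian n E z) = 2 ^ n"
    using carrier_matD[OF hamiltonian_carrier[of n E z]] by auto
  have "hamiltonian n E z *\<^sub>v v = of_real l \<cdot>\<^sub>v v \<longleftrightarrow>
    (\<forall>s<2 ^ n. of_real (z * E s - l) * v $ s = (v \<bullet>c uniform_state n) / complex_of_real (sqrt (2 ^ n)))"
    if v: "v \<in> carrier_vec (2 ^ n)"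
  proof -
    have "hamiltonian n E z *\<^sub>v v = of_real l \<cdot>\<^sub>v v \<longleftrightarrow>
      (\<forall>s<2 ^ n. (hamiltonian n E z *\<^sub>v v) $ s = of_real l * v $ s)"
      using v d by (auto simp: vec_eq_iff)
    also have "\<dots> \<longleftrightarrow> (\<forall>s<2 ^ n. of_real (z * E s - l) * v $ s = (v \<bullet>c uniform_state n) / complex_of_real (sqrt (2 ^ n)))"
    proof -
      have "of_real a * x - b = of_real l * x \<longleftrightarrow> of_real (a - l) * x = b" for a and x b :: complex
        by (auto simp: algebra_simps)
      then show ?thesis using hamiltonian_mult_vec[OF v, of _ E z] by (simp only: cong: all_cong)
    qed
    finally show ?thesis .
  qed
  then show ?thesis unfolding eigenvector_def d by blast
qed

lemma sum_over_levels:
  fixes f :: "nat \<Rightarrow> real"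
  assumes "cost_function n m E"
  shows "(\<Sum>s<2 ^ n. f (E s)) = (\<Sum>e = 0..m. real (level_count n E e) * f e)"
proof -
  have "(\<Sum>s<2 ^ n. f (E s)) = (\<Sum>e = 0..m. \<Sum>s\<in>{s \<in> {..<2 ^ n}. E s = e}. f (E s))"
    using assms by (intro sum.group[symmetric]) (auto simp: cost_function_def)
  also have "\<dots> = (\<Sum>e = 0..m. real (level_count n E e) * f e)"
  proof (rule sum.cong)
    fix e
    have "(\<Sum>s\<in>{s \<in> {..<2 ^ n}. E s = e}. f (E s)) = (\<Sum>s\<in>{s \<in> {..<2 ^ n}. E s = e}. f e)"
      by (rule sum.cong) auto
    then show "(\<Sum>s\<in>{s \<in> {..<2 ^ n}. E s = e}. f (E s)) = real (level_count n E e) * f e"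
      by (simp add: level_count_def)
  qed simp
  finally show ?thesis .
qed

lemma level_count_pos: "s < 2 ^ n \<Longrightarrow> 0 < level_count n E (E s)"
  unfolding level_count_def by (subst card_gt_0_iff) auto

lemma X_fun_eq:
  assumes "cost_function n m E"
  shows "X_fun n m E z l = 1 + (\<Sum>s<2 ^ n. 1 / (l - z * E s)) / 2 ^ n"
  unfolding X_fun_def using sum_over_levels[OF assms, of "\<lambda>e. 1 / (l - z * real e)"] by simp

text \<open>A nonzero overlap \<open>a\<close> determines all components as multiples of
  \<open>a / (l - z E s)\<close>; summing them and cancelling \<open>a\<close> gives
  \<open>X(l) = 0\<close>.\<close>

lemma eigenvalue_overlap_iff_X_root:
  assumes E: "cost_function n m E"
  shows "(\<exists>v. eigenvector (hamiltonian n E z) v (of_real l) \<and> v \<bullet>c uniform_state n \<noteq> 0) \<longleftrightarrow> l \<in> X_roots n m E z"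
proof
  let ?r = "complex_of_real (sqrt (2 ^ n))"
  have r: "?r \<noteq> 0" by simp
  have rr: "?r * ?r = 2 ^ n" by (simp flip: of_real_mult)
  {
    assume "\<exists>v. eigenvector (hamiltonian n E z) v (of_real l) \<and> v \<bullet>c uniform_state n \<noteq> 0"
    then obtain v where v: "v \<in> carrier_vec (2 ^ n)" and c: "v \<bullet>c uniform_state n \<noteq> 0"
      and eq: "\<And>s. s < 2 ^ n \<Longrightarrow> of_real (z * E s - l) * v $ s = (v \<bullet>c uniform_state n) / ?r"
      unfolding eigenvector_hamiltonian_iff by blast
    define a where "a = v \<bullet>c uniform_state n"
    \<comment> \<open>At \<open>l = z E s\<close> the left-hand side of \<open>eq\<close> vanishes,
      against the nonzero overlap.\<close>
    have ne: "z * E s \<noteq> l" if "s < 2 ^ n" for s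
      using eq[OF that] c by auto
    have vs: "v $ s = - (a / ?r) * of_real (1 / (l - z * E s))" if "s < 2 ^ n" for s
    proof -
      have "complex_of_real (z * E s - l) \<noteq> 0" using ne[OF that] unfolding of_real_eq_0_iff by simp
      then have "v $ s = (a / ?r) / of_real (z * E s - l)"
        using eq[OF that] unfolding a_def by (metis nonzero_mult_div_cancel_left)
      also have "\<dots> = - (a / ?r) * of_real (1 / (l - z * E s))"
        by (metis (no_types, opaque_lifting) divide_minus_left minus_diff_eq minus_divide_divide mult.right_neutral of_real_1 of_real_divide of_real_minus times_divide_eq_right)
      finally show ?thesis .
    qed
    have "a = (\<Sum>s<2 ^ n. v $ s) / ?r" using inner_uniform_state[OF v] by (simp add: a_def)
    also have "(\<Sum>s<2 ^ n. v $ s) = - (a / ?r) * of_real (\<Sum>s<2 ^ n. 1 / (l - z * E s))"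
      unfolding of_real_sum sum_distrib_left using vs by (intro sum.cong) auto
    also have "\<dots> / ?r = - a * of_real (\<Sum>s<2 ^ n. 1 / (l - z * E s)) / (?r * ?r)" by simp
    finally have "a = a * (- of_real (\<Sum>s<2 ^ n. 1 / (l - z * E s)) / 2 ^ n)" unfolding rr by simp
    then have "complex_of_real 1 = - of_real (\<Sum>s<2 ^ n. 1 / (l - z * E s)) / 2 ^ n"
      using c unfolding a_def[symmetric] by (metis mult.right_neutral mult_left_cancel of_real_1)
    also have "\<dots> = of_real (- (\<Sum>s<2 ^ n. 1 / (l - z * E s)) / 2 ^ n)" by simp
    finally have "1 = - (\<Sum>s<2 ^ n. 1 / (l - z * E s)) / 2 ^ n" unfolding of_real_eq_iff .
    then have "X_fun n m E z l = 0" unfolding X_fun_eq[OF E] by simp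
    moreover have "l \<noteq> z * real e" if "0 < level_count n E e" for e
      using that ne unfolding level_count_def card_gt_0_iff by blast
    ultimately show "l \<in> X_roots n m E z" by (auto simp: X_roots_def)
  next
    assume l: "l \<in> X_roots n m E z"
    have ne: "l \<noteq> z * E s" if "s < 2 ^ n" for s
      using l E that level_count_pos[OF that, of E] by (auto simp: X_roots_def cost_function_def)
    \<comment> \<open>Up to a scalar this is the vector forced in the other direction; the root
      equation makes its overlap \<open>- sqrt N\<close>.\<close>
    define v where "v = vec (2 ^ n) (\<lambda>s. complex_of_real (1 / (l - z * E s)))"
    have v: "v \<in> carrier_vec (2 ^ n)" by (simp add: v_def)
    have "(\<Sum>s<2 ^ n. 1 / (l - z * E s)) = - (2 ^ n)"
      using l unfolding X_roots_def X_fun_eq[OF E] by (simp add: field_simps)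
    moreover have "(\<Sum>s<2 ^ n. v $ s) = of_real (\<Sum>s<2 ^ n. 1 / (l - z * E s))"
      unfolding of_real_sum by (intro sum.cong) (auto simp: v_def)
    ultimately have "(\<Sum>s<2 ^ n. v $ s) = - (2 ^ n)" by simp
    then have "v \<bullet>c uniform_state n = - (?r * ?r) / ?r"
      unfolding rr using inner_uniform_state[OF v] by simp
    then have a: "v \<bullet>c uniform_state n = - ?r" by simp
    have "complex_of_real (1 / (l - z * E 0)) \<noteq> 0" unfolding of_real_eq_0_iff using ne[of 0] by simp
    then have "v $ 0 \<noteq> 0" by (simp add: v_def)
    then have "v \<noteq> 0\<^sub>v (2 ^ n)" by auto
    moreover have "of_real (z * E s - l) * v $ s = (v \<bullet>c uniform_state n) / ?r" if "s < 2 ^ n" for s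
    proof -
      have "(z * E s - l) * (1 / (l - z * E s)) = - 1" using ne[OF that] by (simp add: field_simps)
      then have "complex_of_real (z * E s - l) * of_real (1 / (l - z * E s)) = of_real (- 1)"
        unfolding of_real_mult[symmetric] by (simp only:)
      then show ?thesis unfolding a using that r by (simp add: v_def)
    qed
    ultimately show "\<exists>v. eigenvector (hamiltonian n E z) v (of_real l) \<and> v \<bullet>c uniform_state n \<noteq> 0"
      using v r unfolding eigenvector_hamiltonian_iff a by (intro exI[of _ v]) (auto simp: a)
  }
qed

text \<open>With zero overlap the eigenvector is supported on states with \<open>z E s = l\<close>,
  and its components sum to 0, which needs two such states. Conversely the difference of two basis
  states of equal cost is an eigenvector.\<close>

lemma eigenvalue_orthogonal_iff_degenerate:
  assumes E: "cost_function n m E" and z: "z \<noteq> 0"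
  shows "(\<exists>v. eigenvector (hamiltonian n E z) v (of_real l) \<and> v \<bullet>c uniform_state n = 0) \<longleftrightarrow>
    (\<exists>e. l = z * real e \<and> 1 < level_count n E e)"
proof
  assume "\<exists>v. eigenvector (hamiltonian n E z) v (of_real l) \<and> v \<bullet>c uniform_state n = 0"
  then obtain v where v: "v \<in> carrier_vec (2 ^ n)" "v \<noteq> 0\<^sub>v (2 ^ n)" and o: "v \<bullet>c uniform_state n = 0"
    and eq: "\<And>s. s < 2 ^ n \<Longrightarrow> of_real (z * E s - l) * v $ s = 0"
    unfolding eigenvector_hamiltonian_iff by auto
  obtain s where s: "s < 2 ^ n" "v $ s \<noteq> 0" using v by (auto simp: vec_eq_iff)
  have "z * E s - l = 0" using eq[OF s(1)] s(2) by (metis mult_eq_0_iff of_real_eq_0_iff)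
  then have l: "l = z * E s" by simp
  have "\<exists>t<2 ^ n. t \<noteq> s \<and> v $ t \<noteq> 0"
  proof (rule ccontr)
    assume "\<not> ?thesis"
    then have "(\<Sum>t<2 ^ n. v $ t) = (\<Sum>t<2 ^ n. if t = s then v $ s else 0)" by (intro sum.cong) auto
    then show False using o s inner_uniform_state[OF v(1)] by simp
  qed
  then obtain t where t: "t < 2 ^ n" "t \<noteq> s" "v $ t \<noteq> 0" by blast
  have "z * E t - l = 0" using eq[OF t(1)] t(3) by (metis mult_eq_0_iff of_real_eq_0_iff)
  then have "E t = E s" using l z by simp
  then have "card {s, t} \<le> level_count n E (E s)"
    unfolding level_count_def using s t by (intro card_mono) auto
  then show "\<exists>e. l = z * real e \<and> 1 < level_count n E e" using l t(2) by (intro exI[of _ "E s"]) auto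
next
  assume "\<exists>e. l = z * real e \<and> 1 < level_count n E e"
  then obtain e where l: "l = z * real e" and "1 < level_count n E e" by blast
  then have "\<not> card {s. s < 2 ^ n \<and> E s = e} \<le> Suc 0" by (simp add: level_count_def)
  moreover have "finite {s. s < 2 ^ n \<and> E s = e}" by simp
  ultimately obtain s t where st: "s < 2 ^ n" "E s = e" "t < 2 ^ n" "E t = e" "s \<noteq> t"
    by (auto simp: card_le_Suc0_iff_eq)
  define v where "v = vec (2 ^ n) (\<lambda>i. if i = s then 1 else if i = t then - 1 else (0::complex))"
  have v: "v \<in> carrier_vec (2 ^ n)" by (simp add: v_def)
  have "(\<Sum>i<2 ^ n. v $ i) = (\<Sum>i<2 ^ n. (if i = s then 1 else 0) + (if i = t then - 1 else 0))"
    using st by (intro sum.cong) (auto simp: v_def)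
  also have "\<dots> = 0" using st by (simp add: sum.distrib)
  finally have o: "v \<bullet>c uniform_state n = 0" using inner_uniform_state[OF v] by simp
  have "v $ s \<noteq> 0" using st by (simp add: v_def)
  then have "v \<noteq> 0\<^sub>v (2 ^ n)" using st by auto
  then show "\<exists>v. eigenvector (hamiltonian n E z) v (of_real l) \<and> v \<bullet>c uniform_state n = 0"
    using v o st l unfolding eigenvector_hamiltonian_iff by (intro exI[of _ v]) (auto simp: v_def)
qed

section \<open>Instances of the optimization problem\<close>

locale cost_instance =
  fixes n m :: nat and E :: "nat \<Rightarrow> nat"
  assumes cost: "cost_function n m E"
    and ground: "0 < level_count n E 0"
    and excited: "level_count n E 0 < 2 ^ n"
begin

text \<open>Empty levels are left out, so all weights are positive and every level is a true pole of
  \<open>X\<close>.\<close>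

definition levels :: "nat set" where "levels = {e \<in> {1..m}. 0 < level_count n E e}"

lemma level_le: "0 < level_count n E e \<Longrightarrow> e \<le> m"
  using cost unfolding level_count_def cost_function_def card_gt_0_iff by blast

lemma sum_levels:
  assumes "\<And>e. level_count n E e = 0 \<Longrightarrow> f e = (0::real)"
  shows "(\<Sum>e = 1..m. f e) = (\<Sum>e\<in>levels. f e)" "(\<Sum>e = 0..m. f e) = f 0 + (\<Sum>e\<in>levels. f e)"
proof -
  show "(\<Sum>e = 1..m. f e) = (\<Sum>e\<in>levels. f e)"
    using assms by (intro sum.mono_neutral_right) (auto simp: levels_def)
  then show "(\<Sum>e = 0..m. f e) = f 0 + (\<Sum>e\<in>levels. f e)" by (simp add: sum.atLeast_Suc_atMost)
qed

lemma densities_total: "level_density n E 0 + (\<Sum>e\<in>levels. level_density n E e) = 1"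
proof -
  have "2 ^ n = (\<Sum>e = 0..m. real (level_count n E e))"
    using sum_over_levels[OF cost, of "\<lambda>_. 1"] by simp
  moreover have "(\<Sum>e = 0..m. level_density n E e) = (\<Sum>e = 0..m. real (level_count n E e)) / 2 ^ n"
    by (simp add: level_density_def sum_divide_distrib)
  ultimately have "(\<Sum>e = 0..m. level_density n E e) = 2 ^ n / 2 ^ n" by (simp only:)
  then have "(\<Sum>e = 0..m. level_density n E e) = 1" by simp
  then show ?thesis by (subst (asm) sum_levels) (auto simp: level_density_def)
qed

text \<open>The bound is \<open>m + 1\<close> instead of \<open>m\<close> so that the resulting
  \<open>K\<close> is positive even where \<open>m n = 0\<close>.\<close>

sublocale level_weights levels "level_density n E" "level_density n E 0" "real m + 1"
proof
  have "level_density n E 0 < 1" using excited by (simp add: level_density_def flip: of_nat_power)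
  then show "levels \<noteq> {}" using densities_total by auto
  show "level_density n E 0 + (\<Sum>e\<in>levels. level_density n E e) = 1" by (rule densities_total)
qed (use ground in \<open>auto simp: levels_def level_density_def\<close>)

lemma Z_moment_eq: "Z_moment n m E p = Z p"
  unfolding Z_moment_def Z_def by (rule sum_levels) (simp add: level_density_def)

text \<open>Rescaling the argument by \<open>z\<close> and multiplying \<open>X\<close> by
  \<open>z\<close> removes \<open>z\<close> from the denominators, leaving it as the value that a
  fixed function must attain.\<close>

lemma X_roots_iff:
  assumes z: "0 < z"
  shows "z * l \<in> X_roots n m E z \<longleftrightarrow>
    l \<noteq> 0 \<and> l \<notin> real ` levels \<and> F l - level_density n E 0 / l = z"
proof -
  have "z * X_fun n m E z (z * l) = z + (\<Sum>e = 0..m. level_density n E e / (l - real e))"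
  proof -
    have "z * (1 / 2 ^ n * (real (level_count n E e) / (z * l - z * real e))) = level_density n E e / (l - real e)" for e
      using z by (simp add: level_density_def right_diff_distrib[symmetric])
    then show ?thesis unfolding X_fun_def by (simp add: distrib_left sum_distrib_left)
  qed
  also have "(\<Sum>e = 0..m. level_density n E e / (l - real e)) =
      level_density n E 0 / l + (\<Sum>e\<in>levels. level_density n E e / (l - real e))"
    by (subst sum_levels) (auto simp: level_density_def)
  also have "(\<Sum>e\<in>levels. level_density n E e / (l - real e)) = - F l"
    unfolding F_def sum_negf[symmetric]
    by (intro sum.cong refl) (metis minus_diff_eq minus_divide_right)
  finally have "X_fun n m E z (z * l) = 0 \<longleftrightarrow> F l - level_density n E 0 / l = z"
    using z by (smt (verit) mult_eq_0_iff)
  moreover have "(\<forall>e\<le>m. level_count n E e > 0 \<longrightarrow> z * l \<noteq> z * real e) \<longleftrightarrow> l \<noteq> 0 \<and> l \<notin> real ` levels"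
  proof -
    have "(\<forall>e\<le>m. level_count n E e > 0 \<longrightarrow> z * l \<noteq> z * real e) \<longleftrightarrow> (\<forall>e\<in>insert 0 levels. l \<noteq> real e)"
      using z ground by (auto simp: levels_def) (metis One_nat_def Suc_leI gr0I of_nat_0)
    then show ?thesis by auto
  qed
  ultimately show ?thesis unfolding X_roots_def by blast
qed

lemma X_roots_below_first_pole:
  assumes z: "0 < z" and l: "l < z * lowest"
  shows "l \<in> X_roots n m E z \<longleftrightarrow> l = - z * neg_root z \<or> l = z * pos_root z"
proof -
  define u where "u = l / z"
  have lu: "l = z * u" using z by (simp add: u_def)
  have uc: "u < lowest" using l z by (simp add: lu)
  then have "u \<notin> real ` levels" using lowest_le by fastforce
  then have "l \<in> X_roots n m E z \<longleftrightarrow> u \<noteq> 0 \<and> F u - level_density n E 0 / u = z"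
    using X_roots_iff[OF z, of u] by (simp add: lu)
  also have "\<dots> \<longleftrightarrow> u = - neg_root z \<or> u = pos_root z"
  proof
    assume u: "u \<noteq> 0 \<and> F u - level_density n E 0 / u = z"
    show "u = - neg_root z \<or> u = pos_root z"
    proof (cases "0 < u")
      case True
      then show ?thesis using pos_root_unique[of u] u uc z by simp
    next
      case False
      then show ?thesis using neg_root_unique[of "- u"] u by simp
    qed
  next
    assume "u = - neg_root z \<or> u = pos_root z"
    then show "u \<noteq> 0 \<and> F u - level_density n E 0 / u = z"
      using neg_root[OF z] pos_root[OF z] by (auto simp: add.commute)
  qed
  also have "\<dots> \<longleftrightarrow> l = - z * neg_root z \<or> l = z * pos_root z"
    using z mult_cancel_left[of z u "- neg_root z"] mult_cancel_left[of z u "pos_root z"] by (simp add: lu)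
  finally show ?thesis .
qed

text \<open>A root not above \<open>z * pos_root z\<close> is one of the two found below the first
  excited pole, which evaluates both \<open>LEAST\<close> operators.\<close>

lemma
  assumes z: "0 < z"
  shows lambda0_eq: "lambda0 n m E z = - z * neg_root z" and lambda1_eq: "lambda1 n m E z = z * pos_root z"
proof -
  have yc: "z * pos_root z < z * lowest" using pos_root(2)[OF z] z by simp
  have x0: "- z * neg_root z < 0" "0 < z * pos_root z" using neg_root(1)[OF z] pos_root(1)[OF z] z by auto
  have roots: "l \<in> X_roots n m E z \<longleftrightarrow> l = - z * neg_root z \<or> l = z * pos_root z" if "l \<le> z * pos_root z" for l
    using X_roots_below_first_pole[OF z, of l] that yc by linarith
  show l0: "lambda0 n m E z = - z * neg_root z"
    unfolding lambda0_def
  proof (rule Least_equality)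
    show "- z * neg_root z \<in> X_roots n m E z" using roots x0 by auto
    show "- z * neg_root z \<le> l" if "l \<in> X_roots n m E z" for l
      using roots[of l] that x0 by linarith
  qed
  show "lambda1 n m E z = z * pos_root z"
    unfolding lambda1_def l0
  proof (rule Least_equality)
    show "z * pos_root z \<in> X_roots n m E z \<and> - z * neg_root z < z * pos_root z" using roots x0 by auto
    show "z * pos_root z \<le> l" if "l \<in> X_roots n m E z \<and> - z * neg_root z < l" for l
      using roots[of l] that by linarith
  qed
qed

lemma gap_eq: "0 < z \<Longrightarrow> gap n m E z = root_gap z"
  by (simp add: gap_def root_gap_def lambda0_eq lambda1_eq algebra_simps)

lemma X_roots_le_lambda1:
  assumes z: "0 < z"
  shows "l \<in> X_roots n m E z \<and> l \<le> lambda1 n m E z \<longleftrightarrow> l = lambda0 n m E z \<or> l = lambda1 n m E z"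
proof -
  have "z * pos_root z < z * lowest" "- z * neg_root z < z * pos_root z"
    using neg_root(1)[OF z] pos_root(1,2)[OF z] z by (auto intro: less_trans[of _ 0])
  then show ?thesis
    using X_roots_below_first_pole[OF z, of l] unfolding lambda0_eq[OF z] lambda1_eq[OF z] by linarith
qed

lemma lambda_signs: "0 < z \<Longrightarrow> lambda0 n m E z < 0" "0 < z \<Longrightarrow> 0 < lambda1 n m E z"
  using neg_root(1) pos_root(1) by (auto simp: lambda0_eq lambda1_eq)

lemma spectrum_overlap:
  assumes z: "0 < z"
  shows "{l :: real. (\<exists>v. eigenvector (hamiltonian n E z) v (complex_of_real l)
                         \<and> v \<bullet>c uniform_state n \<noteq> 0) \<and> l \<le> lambda1 n m E z}
    = {lambda0 n m E z, lambda1 n m E z}"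
  unfolding eigenvalue_overlap_iff_X_root[OF cost] using X_roots_le_lambda1[OF z] by blast

text \<open>Each eigenvalue is a root of \<open>X\<close> or a degenerate level. As
  \<open>lambda1\<close> lies under the first excited pole, the only such level is 0; if degenerate
  it sits strictly between the two roots, with eigenvectors orthogonal to the uniform state.\<close>

lemma spectrum_low:
  assumes z: "0 < z"
  shows "{l :: real. eigenvalue (hamiltonian n E z) (complex_of_real l) \<and> l \<le> lambda1 n m E z}
    = {lambda0 n m E z, lambda1 n m E z} \<union> (if level_count n E 0 > 1 then {0} else {})"
proof -
  have "eigenvalue (hamiltonian n E z) (complex_of_real l) \<longleftrightarrow>
    l \<in> X_roots n m E z \<or> (\<exists>e. l = z * real e \<and> 1 < level_count n E e)" for l
    unfolding eigenvalue_def eigenvalue_overlap_iff_X_root[OF cost, symmetric]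
      eigenvalue_orthogonal_iff_degenerate[OF cost less_imp_neq[OF z, symmetric], symmetric] by blast
  moreover have "(\<exists>e. l = z * real e \<and> 1 < level_count n E e) \<and> l \<le> lambda1 n m E z \<longleftrightarrow>
      l = 0 \<and> 1 < level_count n E 0" for l
  proof
    assume "(\<exists>e. l = z * real e \<and> 1 < level_count n E e) \<and> l \<le> lambda1 n m E z"
    then obtain e where e: "l = z * real e" "1 < level_count n E e" "z * real e \<le> z * pos_root z"
      using lambda1_eq[OF z] by auto
    have "real e < lowest" using e(3) pos_root(2)[OF z] z by simp
    then have "e \<notin> levels" using lowest_le by fastforce
    then have "e = 0" using e(2) level_le[of e] by (auto simp: levels_def)
    then show "l = 0 \<and> 1 < level_count n E 0" using e by simp
  next
    assume "l = 0 \<and> 1 < level_count n E 0"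
    then show "(\<exists>e. l = z * real e \<and> 1 < level_count n E e) \<and> l \<le> lambda1 n m E z"
      using lambda_signs(2)[OF z] by (auto intro!: exI[of _ 0])
  qed
  ultimately have "eigenvalue (hamiltonian n E z) (complex_of_real l) \<and> l \<le> lambda1 n m E z \<longleftrightarrow>
      (l = lambda0 n m E z \<or> l = lambda1 n m E z) \<or> l = 0 \<and> 1 < level_count n E 0" for l
    using X_roots_le_lambda1[OF z, of l] by metis
  then show ?thesis by auto
qed

section \<open>The approximate roots and their relative errors\<close>

definition neg_root_approx :: "real \<Rightarrow> real" where "neg_root_approx z = (gap_root n m E z - (z - Z 1)) / (2 * Z 2)"
definition pos_root_approx :: "real \<Rightarrow> real" where "pos_root_approx z = (gap_root n m E z + (z - Z 1)) / (2 * Z 2)"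

lemma gap_root_eq: "gap_root n m E z = sqrt ((z - Z 1)\<^sup>2 + 4 * level_density n E 0 * Z 2)"
  by (simp add: gap_root_def Z_moment_eq level_density_def)

lemma neg_root_approx: "0 < neg_root_approx z" "Z 2 * neg_root_approx z - level_density n E 0 / neg_root_approx z = Z 1 - z"
  using quadratic_root[OF Z_pos[of 2] n0_pos, of "z - Z 1"] by (simp_all add: neg_root_approx_def gap_root_eq)

lemma pos_root_approx: "0 < pos_root_approx z" "Z 2 * pos_root_approx z - level_density n E 0 / pos_root_approx z = z - Z 1"
  using quadratic_root[OF Z_pos[of 2] n0_pos, of "Z 1 - z"]
  by (simp_all add: pos_root_approx_def gap_root_eq power2_commute algebra_simps)

lemma lambda0_approx_eq: "lambda0_approx n m E z = - z * neg_root_approx z"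
  unfolding lambda0_approx_def neg_root_approx_def Z_moment_eq
  by (metis (no_types, lifting) minus_diff_eq minus_divide_left mult_minus_left mult_minus_right)

lemma lambda1_approx_eq: "lambda1_approx n m E z = z * pos_root_approx z"
  by (simp add: lambda1_approx_def pos_root_approx_def Z_moment_eq algebra_simps)

lemma gap_approx_eq: "gap_approx n m E z = z / Z_moment n m E 2 * gap_root n m E z"
  using Z_pos[of 2]
  by (simp add: gap_approx_def lambda0_approx_eq lambda1_approx_eq neg_root_approx_def pos_root_approx_def Z_moment_eq field_simps)

lemma lambda0_error:
  assumes "level_density n E 0 \<le> 1 / 2" "0 < d" "0 < z" "z_lower n m E d \<le> z"
  shows "\<bar>(lambda0 n m E z - lambda0_approx n m E z) / lambda0 n m E z\<bar>
    \<le> d + 2 * (real m + 1)\<^sup>2 * (level_density n E 0 / d)"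
proof -
  have "(lambda0 n m E z - lambda0_approx n m E z) / lambda0 n m E z = (neg_root z - neg_root_approx z) / neg_root z"
    using assms(3) neg_root(1)[OF assms(3)] by (simp add: lambda0_eq lambda0_approx_eq field_simps)
  then show ?thesis
    using approx_root_neg_error[OF assms(1,2) neg_root[OF assms(3)] neg_root_approx] assms(4)
    by (simp add: z_lower_def Z_moment_eq)
qed

lemma lambda1_error:
  assumes "level_density n E 0 \<le> 1 / 2" "0 < d" "0 < z" "z \<le> z_upper n m E d"
  shows "\<bar>(lambda1 n m E z - lambda1_approx n m E z) / lambda1 n m E z\<bar>
    \<le> d + 8 * (real m + 1)\<^sup>2 * (d\<^sup>2 + level_density n E 0 / d)"
proof -
  have "(lambda1 n m E z - lambda1_approx n m E z) / lambda1 n m E z = (pos_root z - pos_root_approx z) / pos_root z"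
    using assms(3) pos_root(1)[OF assms(3)] by (simp add: lambda1_eq lambda1_approx_eq field_simps)
  then show ?thesis
    using approx_root_pos_error[OF assms(1,2) pos_root[OF assms(3)] pos_root_approx] assms(4)
    by (simp add: z_upper_def Z_moment_eq)
qed

text \<open>As \<open>lambda0 < 0 < lambda1\<close>, the gap is the sum of the absolute values, so a
  common relative error passes to it without cancellation.\<close>

lemma gap_error:
  assumes "0 < z"
    and "\<bar>(lambda0 n m E z - lambda0_approx n m E z) / lambda0 n m E z\<bar> \<le> r"
    and "\<bar>(lambda1 n m E z - lambda1_approx n m E z) / lambda1 n m E z\<bar> \<le> r"
  shows "\<bar>(gap n m E z - gap_approx n m E z) / gap n m E z\<bar> \<le> r"
proof -
  have s: "lambda0 n m E z < 0" "0 < lambda1 n m E z" using lambda_signs assms(1) by auto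
  have "\<bar>a\<bar> \<le> r * \<bar>b\<bar>" if "\<bar>a / b\<bar> \<le> r" "b \<noteq> 0" for a b
    using that by (simp add: abs_divide pos_divide_le_eq)
  from this[OF assms(2)] this[OF assms(3)]
  have "\<bar>lambda0 n m E z - lambda0_approx n m E z\<bar> \<le> r * - lambda0 n m E z"
    "\<bar>lambda1 n m E z - lambda1_approx n m E z\<bar> \<le> r * lambda1 n m E z"
    using s by (simp_all add: abs_of_neg)
  then have "\<bar>gap n m E z - gap_approx n m E z\<bar> \<le> r * gap n m E z"
    unfolding gap_def gap_approx_def right_diff_distrib by linarith
  moreover have "0 < gap n m E z" using s by (simp add: gap_def)
  ultimately show ?thesis by (simp add: abs_divide pos_divide_le_eq)
qed

lemma is_arg_min_gap_iff:
  "is_arg_min (gap n m E) (\<lambda>z. z > 0) zs \<longleftrightarrow> 0 < zs \<and> (\<forall>z>0. root_gap zs \<le> root_gap z)"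
  unfolding is_arg_min_def by (metis gap_eq not_less)

end

section \<open>Uniform constants and the final statement\<close>

lemma poly_bounded_const_times_power:
  assumes f: "poly_bounded f" and f0: "\<And>n. 0 \<le> f n" and a: "0 \<le> a"
  shows "poly_bounded (\<lambda>n. a * (f n + 1) ^ p)"
proof -
  obtain C k where C: "\<And>n. 1 \<le> n \<Longrightarrow> f n \<le> C * real n ^ k"
    using f by (auto simp: poly_bounded_def)
  have "a * (f n + 1) ^ p \<le> a * (\<bar>C\<bar> + 1) ^ p * real n ^ (k * p)" if n: "1 \<le> n" for n
  proof -
    have one: "1 \<le> real n ^ k" using n by simp
    have "C * real n ^ k \<le> \<bar>C\<bar> * real n ^ k" by (intro mult_right_mono) auto
    then have "f n + 1 \<le> (\<bar>C\<bar> + 1) * real n ^ k" using C[OF n] one by (simp add: distrib_right)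
    then have "(f n + 1) ^ p \<le> ((\<bar>C\<bar> + 1) * real n ^ k) ^ p"
      using f0[of n] by (intro power_mono) auto
    then have "a * (f n + 1) ^ p \<le> a * ((\<bar>C\<bar> + 1) * real n ^ k) ^ p" using a by (rule mult_left_mono)
    then show ?thesis by (simp add: power_mult_distrib power_mult mult.assoc)
  qed
  then show ?thesis unfolding poly_bounded_def by blast
qed

text \<open>\<open>K\<close> is fixed before the instance, so the estimates are uniform. The error
  bounds are \<open>d\<close> to leading order, with corrections in \<open>n0 / d\<close> and, where
  \<open>lambda1\<close> is involved, in \<open>d^2\<close>.\<close>

theorem lemma6:
  fixes m :: "nat \<Rightarrow> nat"
  assumes m_poly: "poly_bounded (\<lambda>n. real (m n))"
  shows "\<exists>K :: nat \<Rightarrow> real. poly_bounded K \<and> (\<forall>n\<ge>1. K n > 0) \<and>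
    (\<forall>n\<ge>1. \<forall>E :: nat \<Rightarrow> nat.
      cost_function n (m n) E \<and> 0 < level_count n E 0 \<and> level_count n E 0 < 2 ^ n \<longrightarrow>
      (\<forall>z>0.
        lambda0 n (m n) E z \<in> X_roots n (m n) E z \<and>
        lambda1 n (m n) E z \<in> X_roots n (m n) E z \<and>
        lambda0 n (m n) E z < 0 \<and> 0 < lambda1 n (m n) E z \<and>
        {l :: real. eigenvalue (hamiltonian n E z) (complex_of_real l) \<and> l \<le> lambda1 n (m n) E z}
          = {lambda0 n (m n) E z, lambda1 n (m n) E z}
            \<union> (if level_count n E 0 > 1 then {0} else {}) \<and>
        {l :: real. (\<exists>v. eigenvector (hamiltonian n E z) v (complex_of_real l)
                         \<and> v \<bullet>c uniform_state n \<noteq> 0) \<and> l \<le> lambda1 n (m n) E z}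
          = {lambda0 n (m n) E z, lambda1 n (m n) E z} \<and>
        gap_approx n (m n) E z = z / Z_moment n (m n) E 2 * gap_root n (m n) E z) \<and>
      (let n0 = level_density n E 0; Z1 = Z_moment n (m n) E 1; Z2 = Z_moment n (m n) E 2
       in K n * n0 \<le> 1 \<longrightarrow>
      (\<forall>d>0. \<forall>z>0.
        (z_lower n (m n) E d \<le> z \<longrightarrow>
          \<bar>(lambda0 n (m n) E z - lambda0_approx n (m n) E z) / lambda0 n (m n) E z\<bar>
            \<le> d + K n * (n0 / d)) \<and>
        (z \<le> z_upper n (m n) E d \<longrightarrow>
          \<bar>(lambda1 n (m n) E z - lambda1_approx n (m n) E z) / lambda1 n (m n) E z\<bar>
            \<le> d + K n * (d\<^sup>2 + n0 / d)) \<and>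
        (z_lower n (m n) E d \<le> z \<and> z \<le> z_upper n (m n) E d \<longrightarrow>
          \<bar>(gap n (m n) E z - gap_approx n (m n) E z) / gap n (m n) E z\<bar>
            \<le> d + K n * (d\<^sup>2 + n0 / d))) \<and>
      (\<exists>zs. is_arg_min (gap n (m n) E) (\<lambda>z. z > 0) zs) \<and>
      (\<forall>zs. is_arg_min (gap n (m n) E) (\<lambda>z. z > 0) zs \<longrightarrow>
        \<bar>zs - Z1\<bar> \<le> K n * n0 \<and>
        \<bar>gap n (m n) E zs - 2 * Z1 * sqrt (real (level_count n E 0) / (2 ^ n * Z2))\<bar>
          \<le> K n * n0 powr (3 / 2))))"
\<comment> \<open>The exponent 11 comes from the estimate of the minimal gap, the constant from the
  smallness required in \<open>balanced_point\<close>.\<close>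
proof (intro exI[of _ "\<lambda>n. 3000000 * (real (m n) + 1) ^ 11"] conjI allI impI)
  show "poly_bounded (\<lambda>n. 3000000 * (real (m n) + 1) ^ 11)"
    by (rule poly_bounded_const_times_power[OF m_poly]) auto
  show "0 < 3000000 * (real (m n) + 1) ^ 11" for n by simp
next
  fix n :: nat and E :: "nat \<Rightarrow> nat" and z :: real
  assume A: "cost_function n (m n) E \<and> 0 < level_count n E 0 \<and> level_count n E 0 < 2 ^ n" and z: "0 < z"
  interpret cost_instance n "m n" E using A by unfold_locales auto
  show "lambda0 n (m n) E z \<in> X_roots n (m n) E z" "lambda1 n (m n) E z \<in> X_roots n (m n) E z"
    using X_roots_le_lambda1[OF z] by blast+
  show "lambda0 n (m n) E z < 0" "0 < lambda1 n (m n) E z" using lambda_signs z by auto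
  show "{l :: real. eigenvalue (hamiltonian n E z) (complex_of_real l) \<and> l \<le> lambda1 n (m n) E z}
      = {lambda0 n (m n) E z, lambda1 n (m n) E z} \<union> (if level_count n E 0 > 1 then {0} else {})"
    using spectrum_low[OF z] .
  show "{l :: real. (\<exists>v. eigenvector (hamiltonian n E z) v (complex_of_real l)
                         \<and> v \<bullet>c uniform_state n \<noteq> 0) \<and> l \<le> lambda1 n (m n) E z}
      = {lambda0 n (m n) E z, lambda1 n (m n) E z}"
    using spectrum_overlap[OF z] .
  show "gap_approx n (m n) E z = z / Z_moment n (m n) E 2 * gap_root n (m n) E z"
    by (rule gap_approx_eq)
next
  fix n :: nat and E :: "nat \<Rightarrow> nat"
  assume A: "cost_function n (m n) E \<and> 0 < level_count n E 0 \<and> level_count n E 0 < 2 ^ n"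
  interpret cost_instance n "m n" E using A by unfold_locales auto
  let ?n0 = "level_density n E 0"
  let ?M = "real (m n) + 1"
  let ?K = "3000000 * ?M ^ 11"
  have sqrt_eq: "sqrt (real (level_count n E 0) / (2 ^ n * Z 2)) = sqrt (?n0 / Z 2)"
    by (simp add: level_density_def)
  have M2: "8 * ?M\<^sup>2 \<le> ?K"
  proof -
    have "?M\<^sup>2 \<le> ?M ^ 11" by (intro power_increasing) auto
    then have "8 * ?M\<^sup>2 \<le> 8 * ?M ^ 11" by simp
    also have "\<dots> \<le> ?K" by (intro mult_right_mono) auto
    finally show ?thesis .
  qed
  then have M2': "2 * ?M\<^sup>2 \<le> ?K" using zero_le_power2[of ?M] by linarith
  show "let n0 = ?n0; Z1 = Z_moment n (m n) E 1; Z2 = Z_moment n (m n) E 2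
       in ?K * n0 \<le> 1 \<longrightarrow>
      (\<forall>d>0. \<forall>z>0.
        (z_lower n (m n) E d \<le> z \<longrightarrow>
          \<bar>(lambda0 n (m n) E z - lambda0_approx n (m n) E z) / lambda0 n (m n) E z\<bar>
            \<le> d + ?K * (n0 / d)) \<and>
        (z \<le> z_upper n (m n) E d \<longrightarrow>
          \<bar>(lambda1 n (m n) E z - lambda1_approx n (m n) E z) / lambda1 n (m n) E z\<bar>
            \<le> d + ?K * (d\<^sup>2 + n0 / d)) \<and>
        (z_lower n (m n) E d \<le> z \<and> z \<le> z_upper n (m n) E d \<longrightarrow>
          \<bar>(gap n (m n) E z - gap_approx n (m n) E z) / gap n (m n) E z\<bar>
            \<le> d + ?K * (d\<^sup>2 + n0 / d))) \<and>
      (\<exists>zs. is_arg_min (gap n (m n) E) (\<lambda>z. z > 0) zs) \<and>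
      (\<forall>zs. is_arg_min (gap n (m n) E) (\<lambda>z. z > 0) zs \<longrightarrow>
        \<bar>zs - Z1\<bar> \<le> ?K * n0 \<and>
        \<bar>gap n (m n) E zs - 2 * Z1 * sqrt (real (level_count n E 0) / (2 ^ n * Z2))\<bar>
          \<le> ?K * n0 powr (3 / 2))"
    unfolding Let_def
  proof (intro impI conjI allI)
    assume small: "?K * ?n0 \<le> 1"
    have n0: "?n0 \<le> 1 / 2" using power_M_n0_le[OF small, of 0] by simp
    fix d z :: real assume d: "0 < d" and z: "0 < z"
    have e0: "\<bar>(lambda0 n (m n) E z - lambda0_approx n (m n) E z) / lambda0 n (m n) E z\<bar>
        \<le> d + ?K * (?n0 / d)" if "z_lower n (m n) E d \<le> z"
      using lambda0_error[OF n0 d z that] mult_right_mono[OF M2', of "?n0 / d"] d n0_pos by simp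
    have e1: "\<bar>(lambda1 n (m n) E z - lambda1_approx n (m n) E z) / lambda1 n (m n) E z\<bar>
        \<le> d + ?K * (d\<^sup>2 + ?n0 / d)" if "z \<le> z_upper n (m n) E d"
      using lambda1_error[OF n0 d z that] mult_right_mono[OF M2, of "d\<^sup>2 + ?n0 / d"] d n0_pos by simp
    \<comment> \<open>The error of \<open>lambda0\<close> is weakened to the form for
      \<open>lambda1\<close>, since \<open>gap_error\<close> needs one common bound.\<close>
    have "?K * (?n0 / d) \<le> ?K * (d\<^sup>2 + ?n0 / d)" by (intro mult_left_mono) auto
    with e0 have e0': "\<bar>(lambda0 n (m n) E z - lambda0_approx n (m n) E z) / lambda0 n (m n) E z\<bar>
        \<le> d + ?K * (d\<^sup>2 + ?n0 / d)" if "z_lower n (m n) E d \<le> z"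
      using that by linarith
    show "z_lower n (m n) E d \<le> z \<Longrightarrow>
      \<bar>(lambda0 n (m n) E z - lambda0_approx n (m n) E z) / lambda0 n (m n) E z\<bar> \<le> d + ?K * (?n0 / d)"
      by (rule e0)
    show "z \<le> z_upper n (m n) E d \<Longrightarrow>
      \<bar>(lambda1 n (m n) E z - lambda1_approx n (m n) E z) / lambda1 n (m n) E z\<bar> \<le> d + ?K * (d\<^sup>2 + ?n0 / d)"
      by (rule e1)
    show "z_lower n (m n) E d \<le> z \<and> z \<le> z_upper n (m n) E d \<Longrightarrow>
      \<bar>(gap n (m n) E z - gap_approx n (m n) E z) / gap n (m n) E z\<bar> \<le> d + ?K * (d\<^sup>2 + ?n0 / d)"
      using gap_error[OF z e0' e1] by blast
  next
    assume small: "?K * ?n0 \<le> 1"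
    show "\<exists>zs. is_arg_min (gap n (m n) E) (\<lambda>z. z > 0) zs"
      using ex_min_gap[OF small] unfolding is_arg_min_gap_iff by blast
  next
    fix zs
    assume small: "?K * ?n0 \<le> 1" and "is_arg_min (gap n (m n) E) (\<lambda>z. z > 0) zs"
    then have zs: "0 < zs" "\<And>t. 0 < t \<Longrightarrow> root_gap zs \<le> root_gap t" unfolding is_arg_min_gap_iff by auto
    note est = min_gap_estimates[OF small zs]
    show "\<bar>zs - Z_moment n (m n) E 1\<bar> \<le> ?K * ?n0" using est(1) unfolding Z_moment_eq .
    show "\<bar>gap n (m n) E zs - 2 * Z_moment n (m n) E 1 * sqrt (real (level_count n E 0) / (2 ^ n * Z_moment n (m n) E 2))\<bar>
        \<le> ?K * ?n0 powr (3 / 2)"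
      using est(2) unfolding Z_moment_eq gap_eq[OF zs(1)] sqrt_eq .
  qed
qed

end
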